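(* For every finite graph $G$, \[\tau(G)\ \ge\ \max_{\theta}\ \min_{A}\ \Phi_\theta(A\,|\,\emptyset),\] where $\theta$ ranges over threshold weightings for $G$ and $A$ ranges over join-trees over $G$ with $\langle A\rangle=G$.
   Context: Graphs are simple; subgraphs have no isolated vertices. For $\theta:E(G)\to\mathbb{R}$, $\Delta_\theta(F)=|V(F)|-\sum_{e\in E(F)}\theta(e)$. A threshold weighting for finite $G$ is $\theta:E(G)\to[0,2]$ with $\Delta_\theta(F)\ge 0$ for all $F\subseteq G$ and $\Delta_\theta(G)=0$. For $S\subseteq V(G)$, $F\ominus S$ is the union of the components of $F$ vertex-disjoint from $S$, and $\Delta_\theta(F|S):=\Delta_\theta(F\ominus S)$. Join-trees: finite rooted binary trees (non-leaf nodes have two ordered children) whose leaves are labeled by elements of $E(G)\cup\{\bot\}$; $\langle A\rangle$ is the subgraph formed by the edge labels, $V(A)=V(\langle A\rangle)$, $\Delta_\theta(A|S)=\Delta_\theta(\langle A\rangle\ominus S)$. $[B,C]$ is the join-tree whose root has children $B,C$; one-node join-trees are atomic. $D\preceq A$ if $D$ is the one-node $\bot$-labeled tree, or $D=A$, or $D\preceq$ a child of $A$; $D\prec A$ if $D\preceq A$, $D\neq A$. $\Phi_\theta(A|S)$ ($A$ a join-tree, $S\subseteq V(G)$) is the pointwise minimal function to $\mathbb R_{\ge0}$ satisfying for all $S,A,B,C,D$: (i) $\Phi_\theta(A|S)\ge\Phi_\theta(B|S)+\Delta_\theta(C|S\cup V(B))$ if $A\in\{[B,C],[C,B]\}$; (ii)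 $\Phi_\theta(A|S)\ge\Delta_\theta(B|S)+\Phi_\theta(C|S\cup V(B))$ if $A\in\{[B,C],[C,B]\}$; (iii) $\Phi_\theta(A|S)\ge\frac12\big(\Phi_\theta(D|S)+\Phi_\theta(A|S\cup V(D))+\Delta_\theta(A|S)\big)$ if $D\prec A$. (For atomic $A$, $\Phi_\theta(A|S)=\Delta_\theta(A|S)$.) Pathsets (fix $\theta$ and positive integer $n$): density $\mu(\mathcal A)=|\mathcal A|/n^{|U|}$ for $\mathcal A\subseteq[n]^U$; $x_U$ restriction of a tuple; join $\mathcal B\bowtie\mathcal C=\{z\in[n]^{V\cup W}:z_V\in\mathcal B, z_W\in\mathcal C\}$; restriction $\rho_{V\setminus T}(\mathcal A,z)=\{x\in[n]^{V\setminus T}:\exists y\in\mathcal A, y_{V\setminus T}=x, y_{V\cap T}=z_{V\cap T}\}$ for $\mathcal A\subseteq[n]^V$, $z\in[n]^T$. $\mathcal A\subseteq[n]^{V(F)\setminus S}$ is an $F|S$-pathset if $\mu(\rho_{V(F)\setminus T}(\mathcal A,z))\le n^{-\Delta_\theta(F|T)}$ for all $S\subseteq T\subseteq V(G)$ and $z\in[n]^T$. Pathset complexity $\chi_{\theta,n,A|S}(\mathcal A)$, $\mathcal A\subseteq[n]^{V(A)\setminus S}$: for atomic $A$, the minimum number of $\langle A\rangle|S$-pathsets covering $\mathcal A$; for $A=[B,C]$, the minimum of $\sum_i\max\{\chi_{\theta,n,B|S}(\mathcal B_i),\chi_{\theta,n,C|S}(\mathcal C_i)\}$ over finite families of $\langle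 A\rangle|S$-, $\langle B\rangle|S$-, $\langle C\rangle|S$-pathsets $(\mathcal A_i,\mathcal B_i,\mathcal C_i)$ with $\mathcal A_i\subseteq\mathcal B_i\bowtie\mathcal C_i$ and $\mathcal A\subseteq\bigcup_i\mathcal A_i$. $\tau(G)$: the largest real $t\ge0$ for which there is a threshold weighting $\theta$ for $G$ with $\chi_{\theta,n,A|\emptyset}(\mathcal A)\ge n^{t}\mu(\mathcal A)$ for every join-tree $A$ with $\langle A\rangle=G$, every $n\ge1$ and every $\mathcal A\subseteq[n]^{V(G)}$. *)

theory Defs
  imports Complex_Main "HOL-Library.FuncSet"
begin

section \<open>Graphs and threshold weightings\<close>

datatype 'v graph = Graph (verts: "'v set") (edges: "'v set set")

definition finite_graph :: "'v graph \<Rightarrow> bool" where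
  "finite_graph G \<longleftrightarrow>
     finite (verts G) \<and> (\<forall>e\<in>edges G. e \<subseteq> verts G \<and> card e = 2)"

text \<open>A (sub)graph without isolated vertices is determined by its edges.\<close>

definition graph_of_edges :: "'v set set \<Rightarrow> 'v graph" where
  "graph_of_edges X = Graph (\<Union>X) X"

definition subgraphs :: "'v graph \<Rightarrow> 'v graph set" where
  "subgraphs G = {graph_of_edges X |X. X \<subseteq> edges G}"

definition adj :: "'v graph \<Rightarrow> ('v \<times> 'v) set" where
  "adj F = {(u, v). {u, v} \<in> edges F}"

definition components :: "'v graph \<Rightarrow> 'v set set" where
  "components F = verts F // (adj F)\<^sup>*"

definition ominus :: "'v graph \<Rightarrow> 'v set \<Rightarrow> 'v graph"  (infixl "\<ominus>" 65) where
  "F \<ominus> S = (let W = \<Union>{K \<in> components F. K \<inter> S = {}} in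
              Graph W {e \<in> edges F. e \<subseteq> W})"

definition Delta :: "('v set \<Rightarrow> real) \<Rightarrow> 'v graph \<Rightarrow> real" where
  "Delta \<theta> F = real (card (verts F)) - (\<Sum>e\<in>edges F. \<theta> e)"

definition Delta_on :: "('v set \<Rightarrow> real) \<Rightarrow> 'v graph \<Rightarrow> 'v set \<Rightarrow> real" where
  "Delta_on \<theta> F S = Delta \<theta> (F \<ominus> S)"

definition threshold_weightings :: "'v graph \<Rightarrow> ('v set \<Rightarrow> real) set" where
  "threshold_weightings G =
     {\<theta> \<in> edges G \<rightarrow>\<^sub>E {0..2}. (\<forall>F\<in>subgraphs G. 0 \<le> Delta \<theta> F) \<and> Delta \<theta> G = 0}"

section \<open>Join-trees and the potential \<open>\<Phi>\<close>\<close>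

text \<open>The label \<open>None\<close> plays the role of \<open>\<bottom>\<close>; \<open>labels A\<close> is the set of edge labels of \<open>A\<close>.\<close>

datatype (labels: 'e) join_tree = Leaf "'e option" | Join "'e join_tree" "'e join_tree"

definition tree_graph :: "'v set join_tree \<Rightarrow> 'v graph" where
  "tree_graph A = graph_of_edges (labels A)"

definition tree_verts :: "'v set join_tree \<Rightarrow> 'v set" where
  "tree_verts A = verts (tree_graph A)"

inductive sub_tree :: "'e join_tree \<Rightarrow> 'e join_tree \<Rightarrow> bool" where
  bot: "sub_tree (Leaf None) A"
| refl: "sub_tree A A"
| left: "sub_tree D B \<Longrightarrow> sub_tree D (Join B C)"
| right: "sub_tree D C \<Longrightarrow> sub_tree D (Join B C)"

definition Delta_tree ::
  "('v set \<Rightarrow> real) \<Rightarrow> 'v set join_tree \<Rightarrow> 'v set \<Rightarrow> real" where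
  "Delta_tree \<theta> A S = Delta_on \<theta> (tree_graph A) S"

definition admissible ::
  "'v graph \<Rightarrow> ('v set \<Rightarrow> real) \<Rightarrow> ('v set join_tree \<Rightarrow> 'v set \<Rightarrow> real) \<Rightarrow> bool" where
  "admissible G \<theta> \<phi> \<longleftrightarrow>
     (\<forall>A S. labels A \<subseteq> edges G \<longrightarrow> S \<subseteq> verts G \<longrightarrow>
        0 \<le> \<phi> A S \<and>
        (\<forall>B C. A = Join B C \<or> A = Join C B \<longrightarrow>
           \<phi> A S \<ge> \<phi> B S + Delta_tree \<theta> C (S \<union> tree_verts B)) \<and>
        (\<forall>B C. A = Join B C \<or> A = Join C B \<longrightarrow>
           \<phi> A S \<ge> Delta_tree \<theta> B S + \<phi> C (S \<union> tree_verts B)) \<and>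
        (\<forall>D. sub_tree D A \<and> D \<noteq> A \<longrightarrow>
           \<phi> A S \<ge> (\<phi> D S + \<phi> A (S \<union> tree_verts D) + Delta_tree \<theta> A S) / 2))"

text \<open>
  Only the values at trees labelled in \<open>edges G\<close> and at \<open>S \<subseteq> verts G\<close> are meaningful.  There the
  pointwise infimum is itself admissible, hence the least admissible function: see
  \<open>admissible_Phi\<close>, \<open>Phi_least\<close> and, for one-node trees, \<open>Phi_Leaf\<close> below.
\<close>

definition Phi ::
  "'v graph \<Rightarrow> ('v set \<Rightarrow> real) \<Rightarrow> 'v set join_tree \<Rightarrow> 'v set \<Rightarrow> real" where
  "Phi G \<theta> A S = Inf {\<phi> A S |\<phi>. admissible G \<theta> \<phi>}"

section \<open>Pathsets and pathset complexity\<close>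

definition tuples :: "nat \<Rightarrow> 'v set \<Rightarrow> ('v \<Rightarrow> nat) set" where
  "tuples n U = U \<rightarrow>\<^sub>E {1..n}"

definition density :: "nat \<Rightarrow> 'v set \<Rightarrow> ('v \<Rightarrow> nat) set \<Rightarrow> real" where
  "density n U \<A> = real (card \<A>) / real n ^ card U"

definition join_sets ::
  "nat \<Rightarrow> 'v set \<Rightarrow> 'v set \<Rightarrow> ('v \<Rightarrow> nat) set \<Rightarrow> ('v \<Rightarrow> nat) set \<Rightarrow> ('v \<Rightarrow> nat) set" where
  "join_sets n V W \<B> \<C> = {z \<in> tuples n (V \<union> W). restrict z V \<in> \<B> \<and> restrict z W \<in> \<C>}"

definition restriction ::
  "nat \<Rightarrow> 'v set \<Rightarrow> 'v set \<Rightarrow> ('v \<Rightarrow> nat) set \<Rightarrow> ('v \<Rightarrow> nat) \<Rightarrow> ('v \<Rightarrow> nat) set" where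
  "restriction n V T \<A> z =
     {x \<in> tuples n (V - T). \<exists>y\<in>\<A>. restrict y (V - T) = x \<and> restrict y (V \<inter> T) = restrict z (V \<inter> T)}"

definition pathsets ::
  "'v graph \<Rightarrow> ('v set \<Rightarrow> real) \<Rightarrow> nat \<Rightarrow> 'v graph \<Rightarrow> 'v set \<Rightarrow> ('v \<Rightarrow> nat) set set" where
  "pathsets G \<theta> n F S =
     {\<A>. \<A> \<subseteq> tuples n (verts F - S) \<and>
          (\<forall>T z. S \<subseteq> T \<and> T \<subseteq> verts G \<and> z \<in> tuples n T \<longrightarrow>
             density n (verts F - T) (restriction n (verts F - S) T \<A> z)
               \<le> real n powr (- Delta_on \<theta> F T))}"

text \<open>
  Both minima are over nonempty sets of natural numbers whenever \<open>\<theta>\<close> is nonnegative on the edges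
  and \<open>n \<ge> 1\<close>, because every singleton \<open>{x}\<close> with \<open>x \<in> tuples n (verts F - S)\<close> is then an
  \<open>F|S\<close>-pathset.
\<close>

primrec chi ::
  "'v graph \<Rightarrow> ('v set \<Rightarrow> real) \<Rightarrow> nat \<Rightarrow> 'v set join_tree \<Rightarrow> 'v set \<Rightarrow> ('v \<Rightarrow> nat) set \<Rightarrow> nat" where
  "chi G \<theta> n (Leaf l) S \<A> =
     Inf {card \<P> |\<P>. finite \<P> \<and> \<P> \<subseteq> pathsets G \<theta> n (tree_graph (Leaf l)) S \<and> \<A> \<subseteq> \<Union>\<P>}"
| "chi G \<theta> n (Join B C) S \<A> =
     Inf {(\<Sum>i<m. max (chi G \<theta> n B S (\<B>s i)) (chi G \<theta> n C S (\<C>s i))) |(m::nat) \<A>s \<B>s \<C>s.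
            (\<forall>i<m. \<A>s i \<in> pathsets G \<theta> n (tree_graph (Join B C)) S \<and>
                   \<B>s i \<in> pathsets G \<theta> n (tree_graph B) S \<and>
                   \<C>s i \<in> pathsets G \<theta> n (tree_graph C) S \<and>
                   \<A>s i \<subseteq> join_sets n (tree_verts B - S) (tree_verts C - S) (\<B>s i) (\<C>s i)) \<and>
            \<A> \<subseteq> (\<Union>i<m. \<A>s i)}"

section \<open>The invariant \<open>\<tau>\<close>\<close>

text \<open>
  The largest such \<open>t\<close> is rendered as a supremum; the set is bounded above (\<open>tau_bdd_above\<close>).
  If \<open>G\<close> has an isolated vertex, then it has no threshold weighting and no join-tree \<open>A\<close> with
  \<open>tree_graph A = G\<close>; otherwise there is such a join-tree (\<open>tree_graph_exists\<close>).
\<close>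

definition tau :: "'v graph \<Rightarrow> real" where
  "tau G = Sup {t. 0 \<le> t \<and> (\<exists>\<theta>\<in>threshold_weightings G. \<forall>A n \<A>.
       tree_graph A = G \<and> 1 \<le> n \<and> \<A> \<subseteq> tuples n (verts G) \<longrightarrow>
       real (chi G \<theta> n A {} \<A>) \<ge> real n powr t * density n (verts G) \<A>)}"

section \<open>\<open>Phi\<close> is the least admissible function\<close>

lemma admissible_nonneg:
  "admissible G \<theta> \<phi> \<Longrightarrow> labels A \<subseteq> edges G \<Longrightarrow> S \<subseteq> verts G \<Longrightarrow> 0 \<le> \<phi> A S"
  unfolding admissible_def by blast

lemma Phi_least:
  assumes "admissible G \<theta> \<phi>" "labels A \<subseteq> edges G" "S \<subseteq> verts G"
  shows "Phi G \<theta> A S \<le> \<phi> A S"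
  unfolding Phi_def
proof (rule cInf_lower)
  show "\<phi> A S \<in> {\<phi> A S |\<phi>. admissible G \<theta> \<phi>}" using assms(1) by blast
  show "bdd_below {\<phi> A S |\<phi>. admissible G \<theta> \<phi>}"
    using admissible_nonneg[OF _ assms(2,3)] by (auto intro!: bdd_belowI[of _ 0])
qed

lemma labels_sub_tree: "sub_tree D A \<Longrightarrow> labels D \<subseteq> labels A"
  by (induction rule: sub_tree.induct) auto

lemma tree_verts_subset:
  assumes "finite_graph G" "labels A \<subseteq> edges G"
  shows "tree_verts A \<subseteq> verts G"
  using assms unfolding finite_graph_def tree_verts_def tree_graph_def graph_of_edges_def
  by fastforce

lemma verts_ominus:
  assumes "\<forall>e\<in>edges F. e \<subseteq> verts F"
  shows "verts (F \<ominus> S) \<subseteq> verts F - S"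
proof -
  have r: "v \<in> verts F" if "(u, v) \<in> (adj F)\<^sup>*" "u \<in> verts F" for u v
    using that by (induction rule: rtrancl_induct) (use assms in \<open>auto simp: adj_def\<close>)
  show ?thesis
    by (auto simp: ominus_def Let_def components_def quotient_def intro: r)
qed

lemma Delta_tree_le:
  assumes "finite_graph G" "\<theta> \<in> threshold_weightings G" "labels A \<subseteq> edges G"
  shows "Delta_tree \<theta> A S \<le> card (verts G)"
proof -
  let ?F = "tree_graph A"
  have f: "finite (verts G)" using assms(1) by (simp add: finite_graph_def)
  have "verts (?F \<ominus> S) \<subseteq> verts ?F"
    using verts_ominus[of ?F S] by (auto simp: tree_graph_def graph_of_edges_def)
  also have "\<dots> \<subseteq> verts G" using tree_verts_subset[OF assms(1,3)] by (simp add: tree_verts_def)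
  finally have c: "card (verts (?F \<ominus> S)) \<le> card (verts G)" using f by (rule card_mono[rotated])
  have "0 \<le> (\<Sum>e\<in>edges (?F \<ominus> S). \<theta> e)"
  proof (rule sum_nonneg)
    fix e assume "e \<in> edges (?F \<ominus> S)"
    hence "e \<in> edges G" using assms(3)
      by (auto simp: ominus_def Let_def tree_graph_def graph_of_edges_def)
    thus "0 \<le> \<theta> e" using assms(2) by (auto simp: threshold_weightings_def)
  qed
  thus ?thesis using c by (simp add: Delta_tree_def Delta_on_def Delta_def)
qed

primrec weight :: "'e join_tree \<Rightarrow> nat" where
  "weight (Leaf l) = (case l of None \<Rightarrow> 1 | Some _ \<Rightarrow> 2)"
| "weight (Join B C) = weight B + weight C"

lemma weight_pos: "1 \<le> weight A"
  by (induction A) (auto split: option.splits)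

lemma weight_sub_tree: "sub_tree D A \<Longrightarrow> D = A \<or> weight D < weight A"
proof (induction rule: sub_tree.induct)
  case (bot A)
  show ?case
  proof (cases A)
    case (Leaf l) thus ?thesis by (cases l) auto
  next
    case (Join B C) thus ?thesis using weight_pos[of B] weight_pos[of C] by simp
  qed
next
  case (left D B C) thus ?case using weight_pos[of C] by auto
next
  case (right D C B) thus ?case using weight_pos[of B] by auto
qed auto

lemma admissible_exists:
  assumes "finite_graph G" "\<theta> \<in> threshold_weightings G"
  shows "\<exists>\<phi>. admissible G \<theta> \<phi>"
proof -
  define K where "K = real (card (verts G))"
  have K: "0 \<le> K" by (simp add: K_def)
  have le: "Delta_tree \<theta> A S \<le> K * real (weight A)" if "labels A \<subseteq> edges G" for A S
    using Delta_tree_le[OF assms that, of S] mult_left_mono[OF _ K, of 1 "real (weight A)"]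
      weight_pos[of A] by (simp add: K_def)
  have sub: "(K * real (weight D) + K * real (weight A) + Delta_tree \<theta> A S) / 2
             \<le> K * real (weight A)"
    if "labels A \<subseteq> edges G" "sub_tree D A" "D \<noteq> A" for A D S
  proof -
    have "real (weight D) + 1 \<le> real (weight A)" using weight_sub_tree[OF that(2)] that(3) by simp
    hence "K * (real (weight D) + 1) \<le> K * real (weight A)" by (rule mult_left_mono) (rule K)
    thus ?thesis using Delta_tree_le[OF assms that(1), of S] by (simp add: K_def algebra_simps)
  qed
  have "admissible G \<theta> (\<lambda>A S. K * real (weight A))"
    unfolding admissible_def using le sub K by (auto simp: algebra_simps)
  thus ?thesis by blast
qed

lemma admissible_Phi:
  assumes "finite_graph G" "\<theta> \<in> threshold_weightings G"
  shows "admissible G \<theta> (Phi G \<theta>)"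
proof -
  have ge: "x \<le> Phi G \<theta> A S" if "\<And>\<phi>. admissible G \<theta> \<phi> \<Longrightarrow> x \<le> \<phi> A S" for x A S
    unfolding Phi_def by (rule cInf_greatest) (use admissible_exists[OF assms] that in auto)
  note V = tree_verts_subset[OF assms(1)]
  note le = Phi_least[where G = G and \<theta> = \<theta>]
  show ?thesis
    unfolding admissible_def
  proof (intro allI impI conjI)
    fix A S assume A: "labels A \<subseteq> edges G" and S: "S \<subseteq> verts G"
    show "0 \<le> Phi G \<theta> A S" by (rule ge) (use admissible_nonneg A S in blast)
    {
      fix B C assume AB: "A = Join B C \<or> A = Join C B"
      hence B: "labels B \<subseteq> edges G" and C: "labels C \<subseteq> edges G" using A by auto
      show "Phi G \<theta> B S + Delta_tree \<theta> C (S \<union> tree_verts B) \<le> Phi G \<theta> A S"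
      proof (rule ge)
        fix \<phi> assume a: "admissible G \<theta> \<phi>"
        hence "\<phi> B S + Delta_tree \<theta> C (S \<union> tree_verts B) \<le> \<phi> A S"
          using AB A S unfolding admissible_def by blast
        thus "Phi G \<theta> B S + Delta_tree \<theta> C (S \<union> tree_verts B) \<le> \<phi> A S"
          using le[OF a B S] by simp
      qed
      show "Delta_tree \<theta> B S + Phi G \<theta> C (S \<union> tree_verts B) \<le> Phi G \<theta> A S"
      proof (rule ge)
        fix \<phi> assume a: "admissible G \<theta> \<phi>"
        hence "Delta_tree \<theta> B S + \<phi> C (S \<union> tree_verts B) \<le> \<phi> A S"
          using AB A S unfolding admissible_def by blast
        thus "Delta_tree \<theta> B S + Phi G \<theta> C (S \<union> tree_verts B) \<le> \<phi> A S"
          using le[OF a C, of "S \<union> tree_verts B"] S V[OF B] by simp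
      qed
    }
    {
      fix D assume D: "sub_tree D A \<and> D \<noteq> A"
      hence D': "labels D \<subseteq> edges G" using labels_sub_tree A by blast
      show "(Phi G \<theta> D S + Phi G \<theta> A (S \<union> tree_verts D) + Delta_tree \<theta> A S) / 2 \<le> Phi G \<theta> A S"
      proof (rule ge)
        fix \<phi> assume a: "admissible G \<theta> \<phi>"
        hence "(\<phi> D S + \<phi> A (S \<union> tree_verts D) + Delta_tree \<theta> A S) / 2 \<le> \<phi> A S"
          using D A S unfolding admissible_def by blast
        thus "(Phi G \<theta> D S + Phi G \<theta> A (S \<union> tree_verts D) + Delta_tree \<theta> A S) / 2 \<le> \<phi> A S"
          using le[OF a D' S] le[OF a A, of "S \<union> tree_verts D"] S V[OF D'] by simp
      qed
    }
  qed
qed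

lemma sub_tree_Leaf: "sub_tree D (Leaf l) \<Longrightarrow> D = Leaf None \<or> D = Leaf l"
  by (erule sub_tree.cases) auto

lemma Delta_tree_Leaf_None: "Delta_tree \<theta> (Leaf None) S = 0"
  by (simp add: Delta_tree_def Delta_on_def Delta_def tree_graph_def graph_of_edges_def
      ominus_def components_def)

lemma Delta_tree_nonneg:
  assumes "\<theta> \<in> threshold_weightings G" "labels A \<subseteq> edges G" "finite_graph G"
  shows "0 \<le> Delta_tree \<theta> A S"
proof -
  let ?F = "tree_graph A"
  define W where "W = \<Union>{K \<in> components ?F. K \<inter> S = {}}"
  define X where "X = {e \<in> labels A. e \<subseteq> W}"
  have e: "edges (?F \<ominus> S) = X" and v: "verts (?F \<ominus> S) = W"
    by (auto simp: ominus_def Let_def W_def X_def tree_graph_def graph_of_edges_def)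
  have "W \<subseteq> \<Union>X"
  proof
    fix w assume "w \<in> W"
    then obtain K where K: "K \<in> components ?F" "K \<inter> S = {}" "w \<in> K" by (auto simp: W_def)
    then obtain u where u: "u \<in> verts ?F" "K = (adj ?F)\<^sup>* `` {u}"
      by (auto simp: components_def quotient_def)
    have ed: "edges ?F = labels A" "verts ?F = \<Union>(labels A)"
      by (auto simp: tree_graph_def graph_of_edges_def)
    have "w \<in> verts ?F"
      using verts_ominus[of ?F S] v \<open>w \<in> W\<close> ed by auto
    then obtain d where d: "d \<in> labels A" "w \<in> d" using ed by auto
    have "card d = 2" using assms d by (auto simp: finite_graph_def)
    then obtain a b where ab: "d = {a, b}" by (meson card_2_iff)
    have "x \<in> K" if "x \<in> d" for x
    proof -
      have "x = w \<or> {w, x} = d" using that d(2) ab by auto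
      hence "x = w \<or> (w, x) \<in> adj ?F" using d(1) ed by (auto simp: adj_def)
      thus ?thesis using K(3) u(2) by (auto intro: rtrancl_into_rtrancl)
    qed
    hence "d \<subseteq> W" using K by (auto simp: W_def)
    thus "w \<in> \<Union>X" using d by (auto simp: X_def)
  qed
  hence "?F \<ominus> S = graph_of_edges X"
    using e v by (intro graph.expand) (auto simp: graph_of_edges_def X_def)
  moreover have "X \<subseteq> edges G" using assms(2) by (auto simp: X_def)
  ultimately have "?F \<ominus> S \<in> subgraphs G" by (auto simp: subgraphs_def)
  thus ?thesis using assms(1)
    by (auto simp: threshold_weightings_def Delta_tree_def Delta_on_def)
qed

lemma Phi_Leaf:
  assumes "finite_graph G" "\<theta> \<in> threshold_weightings G" "labels (Leaf l) \<subseteq> edges G" "S \<subseteq> verts G"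
  shows "Phi G \<theta> (Leaf l) S = Delta_tree \<theta> (Leaf l) S"
proof (rule antisym)
  note adm = admissible_Phi[OF assms(1,2)]
  have ge: "Delta_tree \<theta> (Leaf l) S \<le> Phi G \<theta> (Leaf l) S"
    if "labels (Leaf l) \<subseteq> edges G" "S \<subseteq> verts G" for l S
  proof (cases l)
    case None
    thus ?thesis using admissible_nonneg[OF adm that] by (simp add: Delta_tree_Leaf_None)
  next
    case (Some e)
    have "sub_tree (Leaf None) (Leaf l) \<and> Leaf None \<noteq> Leaf l"
      using Some by (auto intro: sub_tree.bot)
    hence "(Phi G \<theta> (Leaf None) S + Phi G \<theta> (Leaf l) (S \<union> tree_verts (Leaf None))
           + Delta_tree \<theta> (Leaf l) S) / 2 \<le> Phi G \<theta> (Leaf l) S"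
      using adm that unfolding admissible_def by blast
    thus ?thesis using admissible_nonneg[OF adm, of "Leaf None" S] that
      by (simp add: tree_verts_def tree_graph_def graph_of_edges_def)
  qed
  thus "Delta_tree \<theta> (Leaf l) S \<le> Phi G \<theta> (Leaf l) S" using assms by blast
  define \<phi> where "\<phi> = (\<lambda>A S. case A of Leaf l \<Rightarrow> Delta_tree \<theta> A S | Join B C \<Rightarrow> Phi G \<theta> A S)"
  have le: "\<phi> A S \<le> Phi G \<theta> A S" if "labels A \<subseteq> edges G" "S \<subseteq> verts G" for A S
    using ge that by (cases A) (auto simp: \<phi>_def)
  have V: "S \<union> tree_verts B \<subseteq> verts G" if "labels B \<subseteq> edges G" "S \<subseteq> verts G" for B S
    using tree_verts_subset[OF assms(1) that(1)] that(2) by simp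
  have "admissible G \<theta> \<phi>"
    unfolding admissible_def
  proof (intro allI impI conjI)
    fix A S assume A: "labels A \<subseteq> edges G" and S: "S \<subseteq> verts G"
    show "0 \<le> \<phi> A S"
      using admissible_nonneg[OF adm A S] Delta_tree_nonneg[OF assms(2) A assms(1)]
      by (cases A) (simp_all add: \<phi>_def)
    {
      fix B C assume AB: "A = Join B C \<or> A = Join C B"
      hence B: "labels B \<subseteq> edges G" and C: "labels C \<subseteq> edges G" using A by auto
      have eq: "\<phi> A S = Phi G \<theta> A S" using AB by (auto simp: \<phi>_def)
      have "Phi G \<theta> B S + Delta_tree \<theta> C (S \<union> tree_verts B) \<le> Phi G \<theta> A S"
        using adm A S AB unfolding admissible_def by blast
      thus "\<phi> B S + Delta_tree \<theta> C (S \<union> tree_verts B) \<le> \<phi> A S"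
        using le[OF B S] eq by simp
      have "Delta_tree \<theta> B S + Phi G \<theta> C (S \<union> tree_verts B) \<le> Phi G \<theta> A S"
        using adm A S AB unfolding admissible_def by blast
      thus "Delta_tree \<theta> B S + \<phi> C (S \<union> tree_verts B) \<le> \<phi> A S"
        using le[OF C V[OF B S]] eq by simp
    }
    {
      fix D assume D: "sub_tree D A \<and> D \<noteq> A"
      hence D': "labels D \<subseteq> edges G" using labels_sub_tree A by blast
      show "(\<phi> D S + \<phi> A (S \<union> tree_verts D) + Delta_tree \<theta> A S) / 2 \<le> \<phi> A S"
      proof (cases A)
        case (Leaf l)
        hence "D = Leaf None" using D sub_tree_Leaf by blast
        thus ?thesis using Leaf
          by (simp add: \<phi>_def Delta_tree_Leaf_None tree_verts_def tree_graph_def graph_of_edges_def)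
      next
        case (Join B C)
        have "(Phi G \<theta> D S + Phi G \<theta> A (S \<union> tree_verts D) + Delta_tree \<theta> A S) / 2 \<le> Phi G \<theta> A S"
          using adm A S D unfolding admissible_def by blast
        thus ?thesis using le[OF D' S] Join by (simp add: \<phi>_def)
      qed
    }
  qed
  from Phi_least[OF this assms(3,4)]
  show "Phi G \<theta> (Leaf l) S \<le> Delta_tree \<theta> (Leaf l) S" by (simp add: \<phi>_def)
qed

section \<open>Upper bounds on \<open>chi\<close> and \<open>tau\<close>\<close>

lemma finite_tuples: "finite U \<Longrightarrow> finite (tuples n U)"
  unfolding tuples_def by (rule finite_PiE) auto

lemma singleton_pathset:
  assumes G: "finite_graph G" and \<theta>: "\<forall>e\<in>edges G. 0 \<le> \<theta> e" and n: "1 \<le> n"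
    and A: "labels A \<subseteq> edges G" and x: "x \<in> tuples n (tree_verts A - S)"
  shows "{x} \<in> pathsets G \<theta> n (tree_graph A) S"
proof -
  let ?F = "tree_graph A"
  have f: "finite (verts ?F)"
    using tree_verts_subset[OF G A] G finite_subset by (auto simp: tree_verts_def finite_graph_def)
  have "density n (verts ?F - T) (restriction n (verts ?F - S) T {x} z) \<le> real n powr (- Delta_on \<theta> ?F T)"
    if T: "S \<subseteq> T" for T z
  proof -
    have sub: "restriction n (verts ?F - S) T {x} z \<subseteq> {restrict x (verts ?F - S - T)}"
      by (auto simp: restriction_def)
    have "card (restriction n (verts ?F - S) T {x} z) \<le> 1"
      using card_mono[OF _ sub] by simp
    hence "density n (verts ?F - T) (restriction n (verts ?F - S) T {x} z)
           \<le> 1 / real n ^ card (verts ?F - T)"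
      by (auto simp: density_def divide_right_mono)
    also have "\<dots> = real n powr (- real (card (verts ?F - T)))"
      using n by (simp add: powr_minus powr_realpow divide_inverse)
    also have "\<dots> \<le> real n powr (- Delta_on \<theta> ?F T)"
    proof (rule powr_mono)
      have "verts (?F \<ominus> T) \<subseteq> verts ?F - T"
        by (rule verts_ominus) (auto simp: tree_graph_def graph_of_edges_def)
      hence "card (verts (?F \<ominus> T)) \<le> card (verts ?F - T)" using f by (intro card_mono) auto
      moreover have "0 \<le> (\<Sum>e\<in>edges (?F \<ominus> T). \<theta> e)"
        using A \<theta> by (intro sum_nonneg)
          (auto simp: ominus_def Let_def tree_graph_def graph_of_edges_def)
      ultimately show "- real (card (verts ?F - T)) \<le> - Delta_on \<theta> ?F T"
        by (simp add: Delta_on_def Delta_def)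
    qed (use n in simp)
    finally show ?thesis .
  qed
  thus ?thesis using x by (auto simp: pathsets_def tree_verts_def)
qed

lemma chi_le_card:
  assumes G: "finite_graph G" and \<theta>: "\<forall>e\<in>edges G. 0 \<le> \<theta> e" and n: "1 \<le> n"
  shows "labels A \<subseteq> edges G \<Longrightarrow> \<A> \<subseteq> tuples n (tree_verts A - S) \<Longrightarrow> chi G \<theta> n A S \<A> \<le> card \<A>"
proof (induction A arbitrary: \<A>)
  case (Leaf l)
  note P = singleton_pathset[OF G \<theta> n Leaf(1)]
  have "finite (tree_verts (Leaf l))"
    using tree_verts_subset[OF G Leaf(1)] G finite_subset by (auto simp: finite_graph_def)
  hence f: "finite \<A>" using Leaf(2) finite_tuples finite_subset by (metis finite_Diff)
  have "card ((\<lambda>x. {x}) ` \<A>) = card \<A>" by (simp add: card_image)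
  hence "card \<A> \<in> {card \<P> |\<P>. finite \<P> \<and> \<P> \<subseteq> pathsets G \<theta> n (tree_graph (Leaf l)) S \<and> \<A> \<subseteq> \<Union>\<P>}"
    using f P Leaf(2) by (auto intro!: exI[of _ "(\<lambda>x. {x}) ` \<A>"])
  thus ?case by (simp only: chi.simps) (rule cInf_lower, auto)
next
  case (Join B C)
  let ?A = "Join B C"
  have l: "labels B \<subseteq> edges G" "labels C \<subseteq> edges G" using Join.prems by auto
  have v: "tree_verts ?A = tree_verts B \<union> tree_verts C"
    by (simp add: tree_verts_def tree_graph_def graph_of_edges_def)
  have "finite (tree_verts ?A)"
    using tree_verts_subset[OF G Join.prems(1)] G finite_subset by (auto simp: finite_graph_def)
  hence f: "finite \<A>" using Join.prems(2) finite_tuples finite_subset by (metis finite_Diff)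
  then obtain h where h: "bij_betw h {..<card \<A>} \<A>"
    using ex_bij_betw_nat_finite atLeast0LessThan by metis
  define \<A>s where "\<A>s i = {h i}" for i
  define \<B>s where "\<B>s i = {restrict (h i) (tree_verts B - S)}" for i
  define \<C>s where "\<C>s i = {restrict (h i) (tree_verts C - S)}" for i
  have hA: "h i \<in> tuples n (tree_verts ?A - S)" if "i < card \<A>" for i
    using h that Join.prems(2) by (auto simp: bij_betw_def)
  have hB: "restrict (h i) (tree_verts B - S) \<in> tuples n (tree_verts B - S)"
    and hC: "restrict (h i) (tree_verts C - S) \<in> tuples n (tree_verts C - S)" if "i < card \<A>" for i
    using hA[OF that] v by (auto simp: tuples_def PiE_def Pi_def)
  have U: "tree_verts B - S \<union> (tree_verts C - S) = tree_verts ?A - S" using v by auto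
  let ?s = "\<Sum>i<card \<A>. max (chi G \<theta> n B S (\<B>s i)) (chi G \<theta> n C S (\<C>s i))"
  have "\<A> \<subseteq> (\<Union>i<card \<A>. \<A>s i)" using h by (auto simp: bij_betw_def \<A>s_def)
  moreover have "\<forall>i<card \<A>. \<A>s i \<in> pathsets G \<theta> n (tree_graph ?A) S \<and>
      \<B>s i \<in> pathsets G \<theta> n (tree_graph B) S \<and> \<C>s i \<in> pathsets G \<theta> n (tree_graph C) S \<and>
      \<A>s i \<subseteq> join_sets n (tree_verts B - S) (tree_verts C - S) (\<B>s i) (\<C>s i)"
    using singleton_pathset[OF G \<theta> n Join.prems(1)] singleton_pathset[OF G \<theta> n l(1)]
      singleton_pathset[OF G \<theta> n l(2)] hA hB hC
    by (auto simp: \<A>s_def \<B>s_def \<C>s_def join_sets_def U)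
  ultimately have "chi G \<theta> n ?A S \<A> \<le> ?s"
    by (simp only: chi.simps) (rule cInf_lower, blast, simp)
  also have "?s \<le> (\<Sum>i<card \<A>. 1)"
  proof (rule sum_mono)
    fix i assume "i \<in> {..<card \<A>}"
    hence "\<B>s i \<subseteq> tuples n (tree_verts B - S)" "\<C>s i \<subseteq> tuples n (tree_verts C - S)"
      using hB hC by (auto simp: \<B>s_def \<C>s_def)
    from Join.IH(1)[OF l(1) this(1)] Join.IH(2)[OF l(2) this(2)]
    show "max (chi G \<theta> n B S (\<B>s i)) (chi G \<theta> n C S (\<C>s i)) \<le> 1"
      by (simp add: \<B>s_def \<C>s_def)
  qed
  finally show ?case by simp
qed

lemma tree_graph_exists:
  assumes "finite_graph G" "verts G = \<Union>(edges G)"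
  shows "\<exists>A. tree_graph A = G"
proof -
  have "edges G \<subseteq> Pow (verts G)" using assms(1) by (auto simp: finite_graph_def)
  hence "finite (edges G)" using assms(1) by (auto simp: finite_graph_def intro: finite_subset)
  hence "\<exists>A. labels A = edges G"
  proof (induction "edges G" arbitrary: G rule: finite_induct)
    case empty
    thus ?case by (intro exI[of _ "Leaf None"]) simp
  next
    case (insert e X)
    from insert.hyps(3)[of "Graph {} X"] obtain A where "labels A = X" by auto
    thus ?case using insert.hyps(4) by (intro exI[of _ "Join (Leaf (Some e)) A"]) simp
  qed
  then obtain A where "labels A = edges G" by blast
  hence "tree_graph A = G"
    using assms(2) by (intro graph.expand) (simp add: tree_graph_def graph_of_edges_def)
  thus ?thesis ..
qed

lemma tau_bdd_above:
  assumes "finite_graph G" "verts G = \<Union>(edges G)"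
  shows "bdd_above {t. 0 \<le> t \<and> (\<exists>\<theta>\<in>threshold_weightings G. \<forall>A n \<A>.
       tree_graph A = G \<and> 1 \<le> n \<and> \<A> \<subseteq> tuples n (verts G) \<longrightarrow>
       real (chi G \<theta> n A {} \<A>) \<ge> real n powr t * density n (verts G) \<A>)}"
proof (rule bdd_aboveI)
  fix t
  let ?T = "tuples 2 (verts G)"
  obtain A where A: "tree_graph A = G" using tree_graph_exists[OF assms] by blast
  hence l: "labels A = edges G" and v: "tree_verts A = verts G"
    by (auto simp: tree_graph_def graph_of_edges_def tree_verts_def)
  have c: "card ?T = 2 ^ card (verts G)"
    using assms(1) by (simp add: tuples_def card_PiE finite_graph_def)
  assume "t \<in> {t. 0 \<le> t \<and> (\<exists>\<theta>\<in>threshold_weightings G. \<forall>A n \<A>.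
       tree_graph A = G \<and> 1 \<le> n \<and> \<A> \<subseteq> tuples n (verts G) \<longrightarrow>
       real (chi G \<theta> n A {} \<A>) \<ge> real n powr t * density n (verts G) \<A>)}"
  then obtain \<theta> where \<theta>: "\<theta> \<in> threshold_weightings G"
    and t: "\<And>A n \<A>. tree_graph A = G \<and> 1 \<le> n \<and> \<A> \<subseteq> tuples n (verts G) \<Longrightarrow>
       real (chi G \<theta> n A {} \<A>) \<ge> real n powr t * density n (verts G) \<A>" by auto
  have "\<forall>e\<in>edges G. 0 \<le> \<theta> e" using \<theta> by (auto simp: threshold_weightings_def)
  hence "chi G \<theta> 2 A {} ?T \<le> card ?T"
    by (intro chi_le_card[OF assms(1)]) (auto simp: l v)
  moreover have "2 powr t \<le> real (chi G \<theta> 2 A {} ?T)"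
    using t[of A 2 ?T] A c by (simp add: density_def)
  ultimately have "2 powr t \<le> real (2 ^ card (verts G))" unfolding c by linarith
  also have "\<dots> = 2 powr real (card (verts G))" by (simp add: powr_realpow)
  finally show "t \<le> real (card (verts G))" by simp
qed

end

theory Submission
  imports Defs
begin

text \<open>
  Fix \<open>\<theta>\<close> and \<open>n \<ge> 2\<close>, and let \<open>\<Psi>(A|S)\<close> be the largest \<open>t\<close> with
  \<open>\<chi>\<^sub>A\<^sub>|\<^sub>S(\<A>) \<ge> n\<^sup>t \<mu>(\<A>)\<close> for all \<open>\<A>\<close>.  Since \<open>\<Phi>\<close> is the least admissible function, it suffices
  that \<open>\<Psi>\<close> is admissible.  All three inequalities rest on the bound
  \<open>\<mu>(\<A>) \<le> \<mu>(\<pi>(\<A>)) * max\<^sub>z \<mu>(\<rho>(\<A>, z))\<close>, where \<open>\<pi>\<close> projects to the vertices of a subtree and \<open>\<rho>\<close>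
  restricts to the remaining ones, and on the fact that pathset complexity does not increase under
  either operation.  For (iii), one may assume that \<open>\<A>\<close> is a pathset, as \<open>\<A>\<close> is covered by pathsets
  whose complexities sum up to at most \<open>\<chi>(\<A>)\<close>; then \<open>\<mu>(\<A>) \<le> \<chi>(\<A>)\<^sup>2 n\<^sup>-\<^sup>\<Psi>\<^sup>(\<^sup>D\<^sup>|\<^sup>S\<^sup>)\<^sup>-\<^sup>\<Psi>\<^sup>(\<^sup>A\<^sup>|\<^sup>S\<^sup>\<union>\<^sup>V\<^sup>(\<^sup>D\<^sup>)\<^sup>)\<close>
  and \<open>\<mu>(\<A>) \<le> n\<^sup>-\<^sup>\<Delta>\<^sup>(\<^sup>A\<^sup>|\<^sup>S\<^sup>)\<close>, and the product of these two bounds is the square of (iii).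
\<close>

section \<open>Tuples, densities and restrictions\<close>

lemma restrict_tuples: "x \<in> tuples n V \<Longrightarrow> U \<subseteq> V \<Longrightarrow> restrict x U \<in> tuples n U"
  unfolding tuples_def by (auto simp: PiE_def Pi_def)

lemma restrict_eq_tuples: "x \<in> tuples n V \<Longrightarrow> restrict x V = x"
  unfolding tuples_def by (simp add: PiE_restrict)

lemma tuples_nonempty: "1 \<le> n \<Longrightarrow> tuples n U \<noteq> {}"
  unfolding tuples_def by (auto simp: PiE_eq_empty_iff)

lemma card_tuples: "finite U \<Longrightarrow> card (tuples n U) = n ^ card U"
  unfolding tuples_def by (simp add: card_PiE)

lemma density_nonneg: "0 \<le> density n U \<A>"
  by (simp add: density_def)

lemma density_mono:
  assumes "finite U" "\<A> \<subseteq> \<B>" "\<B> \<subseteq> tuples n U"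
  shows "density n U \<A> \<le> density n U \<B>"
  unfolding density_def
  using assms card_mono[OF finite_subset[OF assms(3) finite_tuples[OF assms(1)]] assms(2)]
  by (intro divide_right_mono) auto

lemma density_le_1:
  assumes "finite U" "\<A> \<subseteq> tuples n U"
  shows "density n U \<A> \<le> 1"
proof -
  have "card \<A> \<le> n ^ card U"
    using card_mono[OF finite_tuples[OF assms(1)] assms(2)] card_tuples[OF assms(1)] by metis
  thus ?thesis unfolding density_def
    by (metis divide_le_eq_1 of_nat_0_le_iff of_nat_le_iff of_nat_power order_le_less div_by_0 zero_le_one)
qed

lemma density_pos:
  assumes "finite U" "\<A> \<subseteq> tuples n U" "\<A> \<noteq> {}" "1 \<le> n"
  shows "0 < density n U \<A>"
  using assms finite_subset[OF assms(2) finite_tuples[OF assms(1)]]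
  by (auto simp: density_def card_gt_0_iff)

lemma density_UN_le:
  fixes m :: nat
  assumes "finite U" "\<A> \<subseteq> (\<Union>i<m. \<A>s i)" "\<And>i. i < m \<Longrightarrow> \<A>s i \<subseteq> tuples n U"
  shows "density n U \<A> \<le> (\<Sum>i<m. density n U (\<A>s i))"
proof -
  have "finite (\<A>s i)" if "i < m" for i
    using assms(3)[OF that] finite_tuples[OF assms(1)] by (rule finite_subset)
  hence "finite (\<Union>i<m. \<A>s i)" by simp
  hence "card \<A> \<le> card (\<Union>i<m. \<A>s i)" using assms(2) by (rule card_mono)
  also have "\<dots> \<le> (\<Sum>i<m. card (\<A>s i))" by (rule card_UN_le) simp
  finally have "real (card \<A>) \<le> (\<Sum>i<m. real (card (\<A>s i)))"
    by (metis of_nat_le_iff of_nat_sum)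
  thus ?thesis by (simp add: density_def flip: sum_divide_distrib add: divide_right_mono)
qed

section \<open>Restrictions of sets of tuples and the fibre bound\<close>

lemma restriction_subset_tuples: "restriction n V T \<A> z \<subseteq> tuples n (V - T)"
  by (auto simp: restriction_def)

lemma restriction_mono: "\<A> \<subseteq> \<B> \<Longrightarrow> restriction n V T \<A> z \<subseteq> restriction n V T \<B> z"
  by (auto simp: restriction_def)

text \<open>Applied with \<open>V = tree_verts A - S\<close> and \<open>T = S\<close>: the pathset
  condition at \<open>T = S\<close> then bounds the density of the pathset itself.\<close>

lemma restriction_disjoint:
  assumes "\<A> \<subseteq> tuples n V" "V \<inter> T = {}"
  shows "restriction n V T \<A> z = \<A>"
proof -
  have "restrict x V = x" if "x \<in> \<A>" for x using assms(1) that by (auto intro: restrict_eq_tuples)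
  moreover have "restrict y (V \<inter> T) = restrict z (V \<inter> T)" for y using assms(2) by (simp add: restrict_def)
  ultimately show ?thesis using assms by (force simp: restriction_def Diff_triv)
qed

text \<open>Partition \<open>\<A>\<close> into fibres over its projection to
  \<open>V \<inter> T\<close>. Dropping the fixed coordinates embeds each fibre into a restriction
  of \<open>\<A>\<close>, which \<open>m\<close> bounds. Here \<open>\<B>\<close> may be any set
  containing the projection: (i) and (ii) take a set from a decomposition, (iii) takes the image
  itself.\<close>

lemma density_le_projection:
  assumes V: "finite V" and n: "1 \<le> n" and A: "\<A> \<subseteq> tuples n V"
    and B: "\<B> \<subseteq> tuples n (V \<inter> T)" "\<And>x. x \<in> \<A> \<Longrightarrow> restrict x (V \<inter> T) \<in> \<B>"
    and m: "\<And>z. z \<in> tuples n T \<Longrightarrow> density n (V - T) (restriction n V T \<A> z) \<le> m"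
  shows "density n V \<A> \<le> density n (V \<inter> T) \<B> * m"
proof -
  have fB: "finite \<B>" using B(1) finite_tuples V finite_subset by (metis finite_Int)
  have fA: "finite \<A>" using A finite_tuples V finite_subset by metis
  have fib: "real (card {x \<in> \<A>. restrict x (V \<inter> T) = y}) \<le> m * real n ^ card (V - T)"
    if "y \<in> \<B>" for y
  proof -
    obtain z0 where z0: "z0 \<in> tuples n T" using tuples_nonempty[OF n] by blast
    \<comment> \<open>The bound \<open>m\<close> is assumed at points of \<open>tuples n T\<close>
      only, so \<open>y\<close> is extended to all of \<open>T\<close>, with arbitrary values from
      \<open>z0\<close> outside \<open>V\<close>.\<close>
    define z where "z = (\<lambda>v. if v \<in> V \<inter> T then y v else z0 v)"
    have y: "y \<in> tuples n (V \<inter> T)" using B(1) that by blast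
    have z: "z \<in> tuples n T"
      using z0 y by (auto simp: tuples_def z_def PiE_def Pi_def extensional_def)
    have zy: "restrict z (V \<inter> T) = y"
      using restrict_eq_tuples[OF y] restrict_ext[of "V \<inter> T" z y] by (simp add: z_def)
    let ?F = "{x \<in> \<A>. restrict x (V \<inter> T) = y}"
    have inj: "inj_on (\<lambda>x. restrict x (V - T)) ?F"
    proof (rule inj_onI)
      fix a b assume a: "a \<in> ?F" and b: "b \<in> ?F"
        and e: "restrict a (V - T) = restrict b (V - T)"
      have ab: "a \<in> tuples n V" "b \<in> tuples n V" using a b A by blast+
      have "restrict a (V \<inter> T) = y" "restrict b (V \<inter> T) = y" using a b by blast+
      hence e': "restrict a (V \<inter> T) = restrict b (V \<inter> T)" by (rule trans[OF _ sym])
      have "restrict a V v = restrict b V v" for v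
      proof (cases "v \<in> T")
        case True
        thus ?thesis using fun_cong[OF e', of v] by (simp add: restrict_def split: if_splits)
      next
        case False
        thus ?thesis using fun_cong[OF e, of v] by (simp add: restrict_def split: if_splits)
      qed
      hence "restrict a V = restrict b V" by (rule ext)
      thus "a = b" unfolding restrict_eq_tuples[OF ab(1)] restrict_eq_tuples[OF ab(2)] .
    qed
    have sub: "(\<lambda>x. restrict x (V - T)) ` ?F \<subseteq> restriction n V T \<A> z"
    proof (rule image_subsetI)
      fix x assume x: "x \<in> ?F"
      hence "x \<in> \<A>" "restrict x (V \<inter> T) = restrict z (V \<inter> T)" unfolding zy by blast+
      moreover have "restrict x (V - T) \<in> tuples n (V - T)"
        using x A by (intro restrict_tuples[of x n V]) auto
      ultimately show "restrict x (V - T) \<in> restriction n V T \<A> z"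
        unfolding restriction_def by blast
    qed
    have "finite (restriction n V T \<A> z)"
      using restriction_subset_tuples finite_tuples V finite_subset by (metis finite_Diff)
    hence "card ?F \<le> card (restriction n V T \<A> z)"
      by (rule card_inj_on_le[OF inj sub])
    moreover have "real (card (restriction n V T \<A> z)) \<le> m * real n ^ card (V - T)"
      using m[OF z] n by (simp add: density_def field_simps)
    ultimately show ?thesis by linarith
  qed
  have "\<A> \<subseteq> (\<Union>y\<in>\<B>. {x \<in> \<A>. restrict x (V \<inter> T) = y})" using B(2) by blast
  hence "card \<A> \<le> card (\<Union>y\<in>\<B>. {x \<in> \<A>. restrict x (V \<inter> T) = y})"
    using fA fB by (intro card_mono) auto
  also have "\<dots> \<le> (\<Sum>y\<in>\<B>. card {x \<in> \<A>. restrict x (V \<inter> T) = y})"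
    by (rule card_UN_le[OF fB])
  finally have "real (card \<A>) \<le> (\<Sum>y\<in>\<B>. real (card {x \<in> \<A>. restrict x (V \<inter> T) = y}))"
    unfolding of_nat_sum[symmetric] of_nat_le_iff .
  also have "\<dots> \<le> (\<Sum>y\<in>\<B>. m * real n ^ card (V - T))" by (rule sum_mono) (rule fib)
  finally have le: "real (card \<A>) \<le> real (card \<B>) * (m * real n ^ card (V - T))" by simp
  have "card V = card (V \<inter> T) + card (V - T)"
    using V by (metis card_Int_Diff)
  hence "real n ^ card V = real n ^ card (V \<inter> T) * real n ^ card (V - T)"
    by (simp add: power_add)
  thus ?thesis using le n by (simp add: density_def field_simps)
qed

text \<open>Fixing coordinates commutes with passing to \<open>V\<close> or \<open>W\<close>, so
  both membership conditions of the join survive. This allows decompositions to be restricted piece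
  by piece.\<close>

lemma restriction_join_sets_subset:
  assumes "\<A> \<subseteq> join_sets n V W \<B> \<C>"
  shows "restriction n (V \<union> W) T \<A> z
    \<subseteq> join_sets n (V - T) (W - T) (restriction n V T \<B> z) (restriction n W T \<C> z)"
proof
  fix x assume "x \<in> restriction n (V \<union> W) T \<A> z"
  then obtain y where x: "x \<in> tuples n (V \<union> W - T)" and y: "y \<in> \<A>"
    and yx: "restrict y (V \<union> W - T) = x"
    and yz: "restrict y ((V \<union> W) \<inter> T) = restrict z ((V \<union> W) \<inter> T)"
    by (auto simp: restriction_def)
  have r: "restrict x (X - T) \<in> restriction n X T \<X> z"
    if X: "X \<subseteq> V \<union> W" "restrict y X \<in> \<X>" for X \<X>
  proof -
    have "restrict x (X - T) \<in> tuples n (X - T)" using x X(1) by (intro restrict_tuples) auto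
    moreover have "restrict (restrict y X) (X - T) = restrict x (X - T)"
      using X(1) unfolding yx[symmetric] by (auto simp: fun_eq_iff restrict_def)
    moreover have "restrict (restrict y X) (X \<inter> T) = restrict z (X \<inter> T)"
    proof
      fix v show "restrict (restrict y X) (X \<inter> T) v = restrict z (X \<inter> T) v"
        using X(1) fun_cong[OF yz, of v] by (auto simp: restrict_def split: if_splits)
    qed
    ultimately show ?thesis using X(2) by (auto simp: restriction_def simp del: restrict_restrict)
  qed
  have "restrict y V \<in> \<B>" "restrict y W \<in> \<C>" using y assms by (auto simp: join_sets_def)
  thus "x \<in> join_sets n (V - T) (W - T) (restriction n V T \<B> z) (restriction n W T \<C> z)"
    using r x by (auto simp: join_sets_def Un_Diff)
qed

lemma join_sets_commute: "join_sets n V W \<B> \<C> = join_sets n W V \<C> \<B>"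
  by (auto simp: join_sets_def Un_commute)

section \<open>Join-trees and pathsets\<close>

lemma tree_graph_Join_commute: "tree_graph (Join B C) = tree_graph (Join C B)"
  by (simp add: tree_graph_def graph_of_edges_def Un_commute)

lemma verts_tree_graph: "verts (tree_graph A) = tree_verts A"
  by (simp add: tree_verts_def)

lemma tree_verts_Join: "tree_verts (Join B C) = tree_verts B \<union> tree_verts C"
  by (simp add: tree_verts_def tree_graph_def graph_of_edges_def)

lemma tree_verts_sub_tree: "sub_tree D A \<Longrightarrow> tree_verts D \<subseteq> tree_verts A"
  using labels_sub_tree by (fastforce simp: tree_verts_def tree_graph_def graph_of_edges_def)

section \<open>Density bounds and iterated restrictions of pathsets\<close>

lemma pathsets_subset_tuples:
  "\<A> \<in> pathsets G \<theta> n (tree_graph A) S \<Longrightarrow> \<A> \<subseteq> tuples n (tree_verts A - S)"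
  by (simp add: pathsets_def tree_verts_def)

lemma density_restriction_pathset:
  assumes "\<A> \<in> pathsets G \<theta> n (tree_graph A) S" "S \<subseteq> T" "T \<subseteq> verts G" "z \<in> tuples n T"
  shows "density n (tree_verts A - T) (restriction n (tree_verts A - S) T \<A> z)
    \<le> real n powr (- Delta_tree \<theta> A T)"
  using assms by (simp add: pathsets_def tree_verts_def Delta_tree_def)

lemma density_pathset:
  assumes A: "\<A> \<in> pathsets G \<theta> n (tree_graph A) S" and S: "S \<subseteq> verts G" and n: "1 \<le> n"
  shows "density n (tree_verts A - S) \<A> \<le> real n powr (- Delta_tree \<theta> A S)"
proof -
  obtain z where z: "z \<in> tuples n S" using tuples_nonempty[OF n] by blast
  have "restriction n (tree_verts A - S) S \<A> z = \<A>"
    by (rule restriction_disjoint[OF pathsets_subset_tuples[OF A]]) auto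
  thus ?thesis using density_restriction_pathset[OF A subset_refl S z] by simp
qed

text \<open>Fixing \<open>T\<close> by \<open>z\<close> and then \<open>T'\<close> by
  \<open>z'\<close> amounts to fixing \<open>T'\<close> by the glued point that is \<open>z\<close>
  on \<open>T\<close> and \<open>z'\<close> elsewhere. An inclusion suffices for upper bounds on
  densities.\<close>

lemma restriction_restriction_subset:
  assumes "S \<subseteq> T" "T \<subseteq> T'" "z' \<in> tuples n T'" "z \<in> tuples n T"
  obtains z'' where "z'' \<in> tuples n T'"
    "restriction n (V - T) T' (restriction n (V - S) T \<A> z) z' \<subseteq> restriction n (V - S) T' \<A> z''"
proof
  define z'' where "z'' = (\<lambda>v. if v \<in> T then z v else z' v)"
  show "z'' \<in> tuples n T'"
    using assms by (auto simp: z''_def tuples_def PiE_def Pi_def extensional_def)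
  show "restriction n (V - T) T' (restriction n (V - S) T \<A> z) z' \<subseteq> restriction n (V - S) T' \<A> z''"
  proof
    fix w assume "w \<in> restriction n (V - T) T' (restriction n (V - S) T \<A> z) z'"
    then obtain x y where w: "w \<in> tuples n (V - T - T')" and y: "y \<in> \<A>"
      and xw: "restrict x (V - T - T') = w"
      and xz: "restrict x ((V - T) \<inter> T') = restrict z' ((V - T) \<inter> T')"
      and yx: "restrict y (V - S - T) = x"
      and yz: "restrict y ((V - S) \<inter> T) = restrict z ((V - S) \<inter> T)"
      by (auto simp: restriction_def)
    have e: "V - T - T' = V - S - T'" using assms by auto
    have "restrict y (V - S - T') = w"
      using xw[symmetric] yx[symmetric] assms by (auto simp: fun_eq_iff restrict_def)
    moreover have "restrict y ((V - S) \<inter> T') = restrict z'' ((V - S) \<inter> T')"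
    proof
      fix v
      show "restrict y ((V - S) \<inter> T') v = restrict z'' ((V - S) \<inter> T') v"
        using fun_cong[OF yz, of v] fun_cong[OF xz, of v] fun_cong[OF yx, of v] assms(1,2)
        by (auto simp: z''_def restrict_def split: if_splits)
    qed
    ultimately show "w \<in> restriction n (V - S) T' \<A> z''"
      using w y e by (auto simp: restriction_def)
  qed
qed

text \<open>Bounds are carried in the left-hand form, in which they can be multiplied and summed;
  the right-hand form is the one in the definition of \<open>tau\<close>.\<close>

lemma le_mult_powr_minus_iff:
  fixes a x y t :: real
  assumes "0 < a"
  shows "x \<le> y * a powr (- t) \<longleftrightarrow> a powr t * x \<le> y"
proof -
  have "0 < a powr t" using assms by simp
  from pos_le_divide_eq[OF this, of x y] show ?thesis
    by (simp only: powr_minus divide_inverse mult.commute[of x])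
qed

declare chi.simps [simp del]

text \<open>Nonnegativity on the edges and \<open>1 \<le> n\<close> make every singleton a pathset,
  so that the minima defining \<open>chi\<close> are attained.\<close>

locale pathset_setting =
  fixes G :: "'v graph" and \<theta> :: "'v set \<Rightarrow> real" and n :: nat
  assumes G: "finite_graph G" and \<theta>_nonneg: "\<forall>e\<in>edges G. 0 \<le> \<theta> e" and n: "1 \<le> n"
begin

abbreviation pathsets' ("\<P>") where "\<P> A S \<equiv> pathsets G \<theta> n (tree_graph A) S"
abbreviation chi' ("\<chi>") where "\<chi> A S \<A> \<equiv> chi G \<theta> n A S \<A>"
abbreviation tree_tuples where "tree_tuples A S \<equiv> tuples n (tree_verts A - S)"
abbreviation tree_density ("\<mu>") where "\<mu> A S \<A> \<equiv> density n (tree_verts A - S) \<A>"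

lemma finite_tree_verts: "labels A \<subseteq> edges G \<Longrightarrow> finite (tree_verts A - S)"
  using tree_verts_subset[OF G] G by (auto simp: finite_graph_def intro: finite_subset)

text \<open>A further restriction to some \<open>T'\<close> lies inside a single restriction of
  \<open>\<A>\<close> at \<open>T'\<close>, where the defining bound of \<open>\<A>\<close> already
  applies.\<close>

lemma restriction_pathset:
  assumes A: "labels A \<subseteq> edges G" and P: "\<A> \<in> \<P> A S" and T: "S \<subseteq> T" "z \<in> tuples n T"
  shows "restriction n (tree_verts A - S) T \<A> z \<in> \<P> A T"
  unfolding pathsets_def verts_tree_graph
proof (intro CollectI conjI allI impI)
  have e: "tree_verts A - S - U = tree_verts A - U" if "S \<subseteq> U" for U using that by auto
  show "restriction n (tree_verts A - S) T \<A> z \<subseteq> tree_tuples A T"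
    using restriction_subset_tuples[of n "tree_verts A - S" T \<A> z] e[OF T(1)] by simp
  fix T' z' assume T': "T \<subseteq> T' \<and> T' \<subseteq> verts G \<and> z' \<in> tuples n T'"
  then obtain z'' where z'': "z'' \<in> tuples n T'"
    "restriction n (tree_verts A - T) T' (restriction n (tree_verts A - S) T \<A> z) z'
       \<subseteq> restriction n (tree_verts A - S) T' \<A> z''"
    using restriction_restriction_subset[OF T(1) _ _ T(2)] by metis
  have ST: "S \<subseteq> T'" using T T' by auto
  have "\<mu> A T' (restriction n (tree_verts A - T) T' (restriction n (tree_verts A - S) T \<A> z) z')
     \<le> \<mu> A T' (restriction n (tree_verts A - S) T' \<A> z'')"
    using restriction_subset_tuples[of n "tree_verts A - S" T' \<A> z''] e[OF ST]
    by (intro density_mono finite_tree_verts A z'') simp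
  also have "\<dots> \<le> real n powr (- Delta_tree \<theta> A T')"
    using T' ST z'' by (intro density_restriction_pathset[OF P]) auto
  finally show "\<mu> A T' (restriction n (tree_verts A - T) T' (restriction n (tree_verts A - S) T \<A> z) z')
     \<le> real n powr (- Delta_on \<theta> (tree_graph A) T')" by (simp add: Delta_tree_def)
qed

section \<open>Pathset complexity\<close>

text \<open>The condition on the families in the recursive clause of \<open>chi\<close>. The
  covering requirement is kept apart, so that the same families can serve another set, as in
  \<open>chi_mono\<close>.\<close>

definition decomposition ::
  "'v set join_tree \<Rightarrow> 'v set join_tree \<Rightarrow> 'v set \<Rightarrow> nat \<Rightarrow> (nat \<Rightarrow> ('v \<Rightarrow> nat) set)
    \<Rightarrow> (nat \<Rightarrow> ('v \<Rightarrow> nat) set) \<Rightarrow> (nat \<Rightarrow> ('v \<Rightarrow> nat) set) \<Rightarrow> bool" where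
  "decomposition B C S m \<A>s \<B>s \<C>s \<longleftrightarrow>
     (\<forall>i<m. \<A>s i \<in> \<P> (Join B C) S \<and> \<B>s i \<in> \<P> B S \<and> \<C>s i \<in> \<P> C S \<and>
            \<A>s i \<subseteq> join_sets n (tree_verts B - S) (tree_verts C - S) (\<B>s i) (\<C>s i))"

lemma decompositionD:
  assumes "decomposition B C S m \<A>s \<B>s \<C>s" "i < m"
  shows "\<A>s i \<in> \<P> (Join B C) S" "\<B>s i \<in> \<P> B S" "\<C>s i \<in> \<P> C S"
    "\<A>s i \<subseteq> join_sets n (tree_verts B - S) (tree_verts C - S) (\<B>s i) (\<C>s i)"
  using assms by (auto simp: decomposition_def)

section \<open>Upper bounds on complexity and attained minima\<close>

lemma chi_Leaf_le:
  assumes "finite \<Q>" "\<Q> \<subseteq> \<P> (Leaf l) S" "\<A> \<subseteq> \<Union>\<Q>"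
  shows "\<chi> (Leaf l) S \<A> \<le> card \<Q>"
  using assms by (simp only: chi.simps) (rule cInf_lower, blast, simp)

lemma chi_Join_le:
  assumes "decomposition B C S m \<A>s \<B>s \<C>s" "\<A> \<subseteq> (\<Union>i<m. \<A>s i)"
  shows "\<chi> (Join B C) S \<A> \<le> (\<Sum>i<m. max (\<chi> B S (\<B>s i)) (\<chi> C S (\<C>s i)))"
  using assms unfolding decomposition_def
  by (simp only: chi.simps) (rule cInf_lower, blast, simp)

lemma finite_subset_tree_tuples:
  "labels A \<subseteq> edges G \<Longrightarrow> \<A> \<subseteq> tree_tuples A S \<Longrightarrow> finite \<A>"
  using finite_tree_verts finite_tuples finite_subset by metis

text \<open>A nonempty set of naturals contains its infimum; covering \<open>\<A>\<close> by its
  singletons shows nonemptiness.\<close>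

lemma chi_Leaf_attained:
  assumes l: "labels (Leaf l) \<subseteq> edges G" and A: "\<A> \<subseteq> tree_tuples (Leaf l) S"
  obtains \<Q> where "finite \<Q>" "\<Q> \<subseteq> \<P> (Leaf l) S" "\<A> \<subseteq> \<Union>\<Q>" "\<chi> (Leaf l) S \<A> = card \<Q>"
proof -
  let ?X = "{card \<Q> |\<Q>. finite \<Q> \<and> \<Q> \<subseteq> \<P> (Leaf l) S \<and> \<A> \<subseteq> \<Union>\<Q>}"
  have "card ((\<lambda>x. {x}) ` \<A>) \<in> ?X"
    using finite_subset_tree_tuples[OF l A] singleton_pathset[OF G \<theta>_nonneg n l] A
    by (intro CollectI exI[of _ "(\<lambda>x. {x}) ` \<A>"]) auto
  hence "Inf ?X \<in> ?X" by (intro Inf_nat_def1) blast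
  thus ?thesis using that by (auto simp: chi.simps)
qed

lemma chi_Join_attained:
  assumes l: "labels (Join B C) \<subseteq> edges G" and A: "\<A> \<subseteq> tree_tuples (Join B C) S"
  obtains m \<A>s \<B>s \<C>s where "decomposition B C S m \<A>s \<B>s \<C>s" "\<A> \<subseteq> (\<Union>i<m. \<A>s i)"
    "\<chi> (Join B C) S \<A> = (\<Sum>i<m. max (\<chi> B S (\<B>s i)) (\<chi> C S (\<C>s i)))"
proof -
  let ?X = "{(\<Sum>i<m. max (\<chi> B S (\<B>s i)) (\<chi> C S (\<C>s i))) |(m::nat) \<A>s \<B>s \<C>s.
    decomposition B C S m \<A>s \<B>s \<C>s \<and> \<A> \<subseteq> (\<Union>i<m. \<A>s i)}"
  \<comment> \<open>Nonemptiness of \<open>?X\<close>: one piece for each point of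
    \<open>\<A>\<close>, together with the two projections of that point.\<close>
  obtain h where h: "bij_betw h {..<card \<A>} \<A>"
    using ex_bij_betw_nat_finite[OF finite_subset_tree_tuples[OF l A]] atLeast0LessThan by metis
  have hA: "h i \<in> tree_tuples (Join B C) S" if "i < card \<A>" for i
    using h that A by (auto simp: bij_betw_def)
  have "decomposition B C S (card \<A>) (\<lambda>i. {h i}) (\<lambda>i. {restrict (h i) (tree_verts B - S)})
          (\<lambda>i. {restrict (h i) (tree_verts C - S)})"
    unfolding decomposition_def
  proof (intro allI impI conjI)
    fix i assume i: "i < card \<A>"
    show "{h i} \<in> \<P> (Join B C) S" using hA[OF i] by (rule singleton_pathset[OF G \<theta>_nonneg n l])
    show "{restrict (h i) (tree_verts B - S)} \<in> \<P> B S"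
      "{restrict (h i) (tree_verts C - S)} \<in> \<P> C S"
      using l hA[OF i] by (auto intro!: singleton_pathset[OF G \<theta>_nonneg n] elim!: restrict_tuples
          simp: tree_verts_Join)
    show "{h i} \<subseteq> join_sets n (tree_verts B - S) (tree_verts C - S)
        {restrict (h i) (tree_verts B - S)} {restrict (h i) (tree_verts C - S)}"
      using hA[OF i] by (auto simp: join_sets_def tree_verts_Join Un_Diff)
  qed
  moreover have "\<A> \<subseteq> (\<Union>i<card \<A>. {h i})" using h by (auto simp: bij_betw_def)
  ultimately have "?X \<noteq> {}" by blast
  hence "Inf ?X \<in> ?X" by (rule Inf_nat_def1)
  moreover have "\<chi> (Join B C) S \<A> = Inf ?X" by (simp add: chi.simps decomposition_def)
  ultimately show ?thesis using that by auto
qed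

lemma decomposition_commute:
  "decomposition B C S m \<A>s \<B>s \<C>s \<Longrightarrow> decomposition C B S m \<A>s \<C>s \<B>s"
  unfolding decomposition_def
  using tree_graph_Join_commute[of B C] join_sets_commute by (metis (no_types, lifting))

text \<open>Join and \<open>max\<close> are symmetric, so the families can be swapped. Arguments
  about a right child thereby reduce to the left one.\<close>

lemma chi_Join_commute:
  assumes "labels (Join B C) \<subseteq> edges G" "\<A> \<subseteq> tree_tuples (Join B C) S"
  shows "\<chi> (Join B C) S \<A> = \<chi> (Join C B) S \<A>"
proof -
  have le: "\<chi> (Join C B) S \<A> \<le> \<chi> (Join B C) S \<A>"
    if l: "labels (Join B C) \<subseteq> edges G" "\<A> \<subseteq> tree_tuples (Join B C) S" for B C
  proof -
    obtain m \<A>s \<B>s \<C>s where D: "decomposition B C S m \<A>s \<B>s \<C>s" "\<A> \<subseteq> (\<Union>i<m. \<A>s i)"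
      "\<chi> (Join B C) S \<A> = (\<Sum>i<m. max (\<chi> B S (\<B>s i)) (\<chi> C S (\<C>s i)))"
      by (rule chi_Join_attained[OF l])
    show ?thesis
      unfolding D(3) by (subst max.commute) (rule chi_Join_le[OF decomposition_commute[OF D(1)] D(2)])
  qed
  have "labels (Join C B) \<subseteq> edges G" "\<A> \<subseteq> tree_tuples (Join C B) S"
    using assms by (simp_all add: tree_verts_Join Un_commute)
  thus ?thesis by (intro antisym le[OF assms] le)
qed

section \<open>Monotonicity, subadditivity and positivity of complexity\<close>

lemma chi_empty: "labels A \<subseteq> edges G \<Longrightarrow> \<chi> A S {} = 0"
  using chi_le_card[OF G \<theta>_nonneg n, of A "{}" S] by simp

lemma chi_mono:
  assumes "labels A \<subseteq> edges G" "\<A> \<subseteq> \<B>" "\<B> \<subseteq> tree_tuples A S"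
  shows "\<chi> A S \<A> \<le> \<chi> A S \<B>"
proof (cases A)
  case (Leaf l)
  obtain \<Q> where "finite \<Q>" "\<Q> \<subseteq> \<P> (Leaf l) S" "\<B> \<subseteq> \<Union>\<Q>" "\<chi> (Leaf l) S \<B> = card \<Q>"
    by (rule chi_Leaf_attained[OF assms(1,3)[unfolded Leaf]])
  thus ?thesis using chi_Leaf_le[of \<Q> l S \<A>] assms Leaf by auto
next
  case (Join B C)
  obtain m \<A>s \<B>s \<C>s where "decomposition B C S m \<A>s \<B>s \<C>s" "\<B> \<subseteq> (\<Union>i<m. \<A>s i)"
    "\<chi> (Join B C) S \<B> = (\<Sum>i<m. max (\<chi> B S (\<B>s i)) (\<chi> C S (\<C>s i)))"
    by (rule chi_Join_attained[OF assms(1,3)[unfolded Join]])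
  thus ?thesis using chi_Join_le[of B C S m \<A>s \<B>s \<C>s \<A>] assms(2) Join by simp
qed

lemma sum_if_lessThan_add:
  fixes f g :: "nat \<Rightarrow> nat"
  shows "(\<Sum>i<m + k. if i < m then f i else g (i - m)) = (\<Sum>i<m. f i) + (\<Sum>i<k. g i)"
  by (induction k) auto

lemma chi_Un_le:
  assumes l: "labels A \<subseteq> edges G" and A: "\<A> \<subseteq> tree_tuples A S" and B: "\<B> \<subseteq> tree_tuples A S"
  shows "\<chi> A S (\<A> \<union> \<B>) \<le> \<chi> A S \<A> + \<chi> A S \<B>"
proof (cases A)
  case (Leaf l)
  obtain \<Q> where Q: "finite \<Q>" "\<Q> \<subseteq> \<P> (Leaf l) S" "\<A> \<subseteq> \<Union>\<Q>" "\<chi> (Leaf l) S \<A> = card \<Q>"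
    by (rule chi_Leaf_attained[OF l[unfolded Leaf] A[unfolded Leaf]])
  obtain \<R> where R: "finite \<R>" "\<R> \<subseteq> \<P> (Leaf l) S" "\<B> \<subseteq> \<Union>\<R>" "\<chi> (Leaf l) S \<B> = card \<R>"
    by (rule chi_Leaf_attained[OF l[unfolded Leaf] B[unfolded Leaf]])
  have "\<chi> (Leaf l) S (\<A> \<union> \<B>) \<le> card (\<Q> \<union> \<R>)" using Q R by (intro chi_Leaf_le) auto
  thus ?thesis using card_Un_le[of \<Q> \<R>] Q(4) R(4) Leaf by simp
next
  case (Join B' C)
  obtain m \<A>s \<B>s \<C>s where D: "decomposition B' C S m \<A>s \<B>s \<C>s" "\<A> \<subseteq> (\<Union>i<m. \<A>s i)"
    "\<chi> (Join B' C) S \<A> = (\<Sum>i<m. max (\<chi> B' S (\<B>s i)) (\<chi> C S (\<C>s i)))"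
    by (rule chi_Join_attained[OF l[unfolded Join] A[unfolded Join]])
  obtain k \<A>t \<B>t \<C>t where E: "decomposition B' C S k \<A>t \<B>t \<C>t" "\<B> \<subseteq> (\<Union>i<k. \<A>t i)"
    "\<chi> (Join B' C) S \<B> = (\<Sum>i<k. max (\<chi> B' S (\<B>t i)) (\<chi> C S (\<C>t i)))"
    by (rule chi_Join_attained[OF l[unfolded Join] B[unfolded Join]])
  \<comment> \<open>Concatenation of the two optimal decompositions: indices from \<open>m\<close>
    on, shifted by \<open>m\<close>, address the second one.\<close>
  define glue :: "(nat \<Rightarrow> ('v \<Rightarrow> nat) set) \<Rightarrow> (nat \<Rightarrow> ('v \<Rightarrow> nat) set) \<Rightarrow> nat \<Rightarrow> ('v \<Rightarrow> nat) set"
    where "glue f g i = (if i < m then f i else g (i - m))" for f g i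
  have "decomposition B' C S (m + k) (glue \<A>s \<A>t) (glue \<B>s \<B>t) (glue \<C>s \<C>t)"
    using D(1) E(1) by (auto simp: decomposition_def glue_def)
  moreover have "\<A> \<union> \<B> \<subseteq> (\<Union>i<m + k. glue \<A>s \<A>t i)"
  proof
    fix x assume "x \<in> \<A> \<union> \<B>"
    then consider i where "i < m" "x \<in> \<A>s i" | i where "i < k" "x \<in> \<A>t i" using D(2) E(2) by blast
    thus "x \<in> (\<Union>i<m + k. glue \<A>s \<A>t i)"
    proof cases
      case 1 thus ?thesis by (intro UN_I[of i]) (auto simp: glue_def)
    next
      case 2 thus ?thesis by (intro UN_I[of "m + i"]) (auto simp: glue_def)
    qed
  qed
  ultimately have "\<chi> (Join B' C) S (\<A> \<union> \<B>)
      \<le> (\<Sum>i<m + k. max (\<chi> B' S (glue \<B>s \<B>t i)) (\<chi> C S (glue \<C>s \<C>t i)))"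
    by (rule chi_Join_le)
  also have "\<dots> = (\<Sum>i<m + k. if i < m then max (\<chi> B' S (\<B>s i)) (\<chi> C S (\<C>s i))
      else max (\<chi> B' S (\<B>t (i - m))) (\<chi> C S (\<C>t (i - m))))"
    by (intro sum.cong) (auto simp: glue_def)
  also have "\<dots> = \<chi> (Join B' C) S \<A> + \<chi> (Join B' C) S \<B>"
    unfolding D(3) E(3) by (rule sum_if_lessThan_add)
  finally show ?thesis using Join by simp
qed

lemma chi_UN_le:
  fixes m :: nat
  assumes l: "labels A \<subseteq> edges G" and A: "\<And>i. i < m \<Longrightarrow> \<A>s i \<subseteq> tree_tuples A S"
  shows "\<chi> A S (\<Union>i<m. \<A>s i) \<le> (\<Sum>i<m. \<chi> A S (\<A>s i))"
  using A
proof (induction m)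
  case 0 thus ?case using chi_empty[OF l] by simp
next
  case (Suc m)
  have "(\<Union>i<Suc m. \<A>s i) = (\<Union>i<m. \<A>s i) \<union> \<A>s m" by (auto simp: less_Suc_eq)
  hence "\<chi> A S (\<Union>i<Suc m. \<A>s i) \<le> \<chi> A S (\<Union>i<m. \<A>s i) + \<chi> A S (\<A>s m)"
    using Suc.prems by (simp only:) (intro chi_Un_le l, auto simp: less_SucI)
  thus ?case using Suc.IH Suc.prems by simp
qed

text \<open>A point of \<open>\<A>\<close> projects to a point of some \<open>\<B>s i\<close>.
  Following left children down reaches a leaf, where covering a nonempty set takes at least one
  pathset.\<close>

lemma chi_pos:
  "labels A \<subseteq> edges G \<Longrightarrow> \<A> \<subseteq> tree_tuples A S \<Longrightarrow> \<A> \<noteq> {} \<Longrightarrow> 1 \<le> \<chi> A S \<A>"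
proof (induction A arbitrary: \<A>)
  case (Leaf l)
  obtain \<Q> where "finite \<Q>" "\<A> \<subseteq> \<Union>\<Q>" "\<chi> (Leaf l) S \<A> = card \<Q>"
    using chi_Leaf_attained[OF Leaf(1,2)] by metis
  moreover have "\<Q> \<noteq> {}" using \<open>\<A> \<subseteq> \<Union>\<Q>\<close> Leaf(3) by auto
  ultimately show ?case by (simp add: Suc_le_eq card_gt_0_iff)
next
  case (Join B C)
  obtain m \<A>s \<B>s \<C>s where D: "decomposition B C S m \<A>s \<B>s \<C>s" "\<A> \<subseteq> (\<Union>i<m. \<A>s i)"
    "\<chi> (Join B C) S \<A> = (\<Sum>i<m. max (\<chi> B S (\<B>s i)) (\<chi> C S (\<C>s i)))"
    by (rule chi_Join_attained[OF Join.prems(1,2)])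
  obtain x i where x: "i < m" "x \<in> \<A>s i" using Join.prems(3) D(2) by blast
  hence "restrict x (tree_verts B - S) \<in> \<B>s i"
    using decompositionD(4)[OF D(1), of i] by (auto simp: join_sets_def)
  hence "1 \<le> \<chi> B S (\<B>s i)"
    using Join.prems(1) pathsets_subset_tuples[OF decompositionD(2)[OF D(1) x(1)]]
    by (intro Join.IH(1)) auto
  also have "\<dots> \<le> (\<Sum>i<m. max (\<chi> B S (\<B>s i)) (\<chi> C S (\<C>s i)))"
    using x(1) by (intro order_trans[OF _ member_le_sum[of i]]) auto
  finally show ?case using D(3) by simp
qed

text \<open>At a leaf each pathset of an optimal cover covers itself at cost at most 1. At a join
  each triple of an optimal decomposition is itself a decomposition of length one, so
  \<open>\<A>s i\<close> costs at most its own summand.\<close>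

lemma chi_cover_pathsets:
  assumes l: "labels A \<subseteq> edges G" and A: "\<A> \<subseteq> tree_tuples A S"
  obtains m :: nat and \<A>s where "\<And>i. i < m \<Longrightarrow> \<A>s i \<in> \<P> A S" "\<A> \<subseteq> (\<Union>i<m. \<A>s i)"
    "(\<Sum>i<m. \<chi> A S (\<A>s i)) \<le> \<chi> A S \<A>"
proof (cases A)
  case (Leaf l)
  obtain \<Q> where Q: "finite \<Q>" "\<Q> \<subseteq> \<P> (Leaf l) S" "\<A> \<subseteq> \<Union>\<Q>" "\<chi> (Leaf l) S \<A> = card \<Q>"
    by (rule chi_Leaf_attained[OF l[unfolded Leaf] A[unfolded Leaf]])
  obtain h where h: "bij_betw h {..<card \<Q>} \<Q>"
    using ex_bij_betw_nat_finite[OF Q(1)] atLeast0LessThan by metis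
  have hQ: "h i \<in> \<P> (Leaf l) S" if "i < card \<Q>" for i using h that Q(2) by (auto simp: bij_betw_def)
  have "\<chi> (Leaf l) S (h i) \<le> 1" if "i < card \<Q>" for i
    using chi_Leaf_le[of "{h i}" l S "h i"] hQ[OF that] by simp
  hence "(\<Sum>i<card \<Q>. \<chi> (Leaf l) S (h i)) \<le> (\<Sum>i<card \<Q>. 1)" by (intro sum_mono) auto
  hence "(\<Sum>i<card \<Q>. \<chi> (Leaf l) S (h i)) \<le> \<chi> (Leaf l) S \<A>" unfolding Q(4) by simp
  moreover have "\<A> \<subseteq> (\<Union>i<card \<Q>. h i)" using Q(3) bij_betw_imp_surj_on[OF h] by simp
  ultimately show ?thesis by (intro that[of "card \<Q>" h, unfolded Leaf] hQ)
next
  case (Join B C)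
  obtain m \<A>s \<B>s \<C>s where D: "decomposition B C S m \<A>s \<B>s \<C>s" "\<A> \<subseteq> (\<Union>i<m. \<A>s i)"
    "\<chi> (Join B C) S \<A> = (\<Sum>i<m. max (\<chi> B S (\<B>s i)) (\<chi> C S (\<C>s i)))"
    by (rule chi_Join_attained[OF l[unfolded Join] A[unfolded Join]])
  have "\<chi> (Join B C) S (\<A>s i) \<le> max (\<chi> B S (\<B>s i)) (\<chi> C S (\<C>s i))" if "i < m" for i
    using chi_Join_le[of B C S 1 "\<lambda>_. \<A>s i" "\<lambda>_. \<B>s i" "\<lambda>_. \<C>s i" "\<A>s i"] D(1) that
    by (simp add: decomposition_def lessThan_Suc)
  hence "(\<Sum>i<m. \<chi> (Join B C) S (\<A>s i)) \<le> \<chi> (Join B C) S \<A>"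
    unfolding D(3) by (intro sum_mono) blast
  thus ?thesis by (intro that[of m \<A>s, unfolded Join] D(2) decompositionD(1)[OF D(1)])
qed

section \<open>Complexity under restriction and projection\<close>

text \<open>Restrict every set of an optimal cover or decomposition. Pathsets stay pathsets, joins
  stay joins, and by induction no summand grows.\<close>

lemma chi_restriction_le:
  assumes T: "S \<subseteq> T" "z \<in> tuples n T"
  shows "labels A \<subseteq> edges G \<Longrightarrow> \<A> \<subseteq> tree_tuples A S
    \<Longrightarrow> \<chi> A T (restriction n (tree_verts A - S) T \<A> z) \<le> \<chi> A S \<A>"
proof (induction A arbitrary: \<A>)
  case (Leaf l)
  let ?\<rho> = "\<lambda>X. restriction n (tree_verts (Leaf l) - S) T X z"
  obtain \<Q> where Q: "finite \<Q>" "\<Q> \<subseteq> \<P> (Leaf l) S" "\<A> \<subseteq> \<Union>\<Q>" "\<chi> (Leaf l) S \<A> = card \<Q>"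
    by (rule chi_Leaf_attained[OF Leaf])
  have "?\<rho> ` \<Q> \<subseteq> \<P> (Leaf l) T" using Q(2) restriction_pathset[OF Leaf(1) _ T] by blast
  moreover have "?\<rho> \<A> \<subseteq> \<Union>(?\<rho> ` \<Q>)" using Q(3) by (auto simp: restriction_def)
  ultimately have "\<chi> (Leaf l) T (?\<rho> \<A>) \<le> card (?\<rho> ` \<Q>)" using Q(1) by (intro chi_Leaf_le) auto
  thus ?case using card_image_le[OF Q(1), of ?\<rho>] Q(4) by simp
next
  case (Join B C)
  let ?\<rho> = "\<lambda>D X. restriction n (tree_verts D - S) T X z"
  obtain m \<A>s \<B>s \<C>s where D: "decomposition B C S m \<A>s \<B>s \<C>s" "\<A> \<subseteq> (\<Union>i<m. \<A>s i)"
    "\<chi> (Join B C) S \<A> = (\<Sum>i<m. max (\<chi> B S (\<B>s i)) (\<chi> C S (\<C>s i)))"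
    by (rule chi_Join_attained[OF Join.prems(1,2)])
  have l: "labels B \<subseteq> edges G" "labels C \<subseteq> edges G" using Join.prems by auto
  have e: "X - S - T = X - T" for X using T(1) by auto
  have "decomposition B C T m (\<lambda>i. ?\<rho> (Join B C) (\<A>s i)) (\<lambda>i. ?\<rho> B (\<B>s i)) (\<lambda>i. ?\<rho> C (\<C>s i))"
    unfolding decomposition_def
  proof (intro allI impI conjI)
    fix i assume i: "i < m"
    note d = decompositionD[OF D(1) i]
    show "?\<rho> (Join B C) (\<A>s i) \<in> \<P> (Join B C) T" "?\<rho> B (\<B>s i) \<in> \<P> B T" "?\<rho> C (\<C>s i) \<in> \<P> C T"
      by (rule restriction_pathset[OF Join.prems(1) d(1) T] restriction_pathset[OF l(1) d(2) T]
          restriction_pathset[OF l(2) d(3) T])+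
    show "?\<rho> (Join B C) (\<A>s i)
      \<subseteq> join_sets n (tree_verts B - T) (tree_verts C - T) (?\<rho> B (\<B>s i)) (?\<rho> C (\<C>s i))"
      using restriction_join_sets_subset[OF d(4), of T z] by (simp add: e tree_verts_Join Un_Diff)
  qed
  moreover have "?\<rho> (Join B C) \<A> \<subseteq> (\<Union>i<m. ?\<rho> (Join B C) (\<A>s i))"
  proof -
    have "?\<rho> (Join B C) \<A> \<subseteq> ?\<rho> (Join B C) (\<Union>i<m. \<A>s i)" by (rule restriction_mono[OF D(2)])
    also have "\<dots> \<subseteq> (\<Union>i<m. ?\<rho> (Join B C) (\<A>s i))" by (auto simp: restriction_def)
    finally show ?thesis .
  qed
  ultimately have "\<chi> (Join B C) T (?\<rho> (Join B C) \<A>)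
      \<le> (\<Sum>i<m. max (\<chi> B T (?\<rho> B (\<B>s i))) (\<chi> C T (?\<rho> C (\<C>s i))))"
    by (rule chi_Join_le)
  also have "\<dots> \<le> \<chi> (Join B C) S \<A>"
    unfolding D(3)
  proof (intro sum_mono max.mono)
    fix i assume "i \<in> {..<m}"
    hence i: "i < m" by simp
    show "\<chi> B T (?\<rho> B (\<B>s i)) \<le> \<chi> B S (\<B>s i)" "\<chi> C T (?\<rho> C (\<C>s i)) \<le> \<chi> C S (\<C>s i)"
      by (rule Join.IH l pathsets_subset_tuples decompositionD(2,3)[OF D(1) i])+
  qed
  finally show ?case .
qed

text \<open>Projection to \<open>tree_verts D\<close> factors through \<open>tree_verts B\<close>,
  so the image of \<open>\<A>s i\<close> lies in the image of \<open>\<B>s i\<close>. Subadditivity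
  and \<open>IH\<close> bound the total cost. Kept apart from the induction so that it also yields
  the right-child case, after swapping.\<close>

lemma chi_projection_Join_le:
  assumes sub: "sub_tree D B" and l: "labels (Join B C) \<subseteq> edges G"
    and A: "\<A> \<subseteq> tree_tuples (Join B C) S"
    and IH: "\<And>\<B>. \<B> \<subseteq> tree_tuples B S
      \<Longrightarrow> \<chi> D S ((\<lambda>x. restrict x (tree_verts D - S)) ` \<B>) \<le> \<chi> B S \<B>"
  shows "\<chi> D S ((\<lambda>x. restrict x (tree_verts D - S)) ` \<A>) \<le> \<chi> (Join B C) S \<A>"
proof -
  have lD: "labels D \<subseteq> edges G"
    using l labels_sub_tree[OF sub] by auto
  have v: "tree_verts D \<subseteq> tree_verts B" by (rule tree_verts_sub_tree[OF sub])
  obtain m \<A>s \<B>s \<C>s where D: "decomposition B C S m \<A>s \<B>s \<C>s" "\<A> \<subseteq> (\<Union>i<m. \<A>s i)"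
    "\<chi> (Join B C) S \<A> = (\<Sum>i<m. max (\<chi> B S (\<B>s i)) (\<chi> C S (\<C>s i)))"
    by (rule chi_Join_attained[OF l A])
  let ?\<pi> = "\<lambda>x :: 'v \<Rightarrow> nat. restrict x (tree_verts D - S)"
  have t: "\<B>s i \<subseteq> tree_tuples B S" if "i < m" for i
    using pathsets_subset_tuples[OF decompositionD(2)[OF D(1) that]] .
  have tD: "?\<pi> ` \<B>s i \<subseteq> tree_tuples D S" if "i < m" for i
    using t[OF that] v by (auto intro!: restrict_tuples[of _ n "tree_verts B - S"])
  have "?\<pi> ` \<A> \<subseteq> (\<Union>i<m. ?\<pi> ` \<B>s i)"
  proof (rule image_subsetI)
    fix x assume "x \<in> \<A>"
    then obtain i where i: "i < m" "x \<in> \<A>s i" using D(2) by blast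
    hence "restrict x (tree_verts B - S) \<in> \<B>s i"
      using decompositionD(4)[OF D(1) i(1)] by (auto simp: join_sets_def)
    moreover have "?\<pi> x = ?\<pi> (restrict x (tree_verts B - S))"
      using v by (auto simp: fun_eq_iff restrict_def)
    ultimately show "?\<pi> x \<in> (\<Union>i<m. ?\<pi> ` \<B>s i)" using i(1) by blast
  qed
  hence "\<chi> D S (?\<pi> ` \<A>) \<le> \<chi> D S (\<Union>i<m. ?\<pi> ` \<B>s i)"
    using tD by (intro chi_mono lD UN_least) auto
  also have "\<dots> \<le> (\<Sum>i<m. \<chi> D S (?\<pi> ` \<B>s i))" by (intro chi_UN_le lD tD)
  also have "\<dots> \<le> \<chi> (Join B C) S \<A>"
    unfolding D(3) using IH[OF t] by (intro sum_mono) (simp add: max.coboundedI1)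
  finally show ?thesis .
qed

lemma chi_projection_le:
  assumes "sub_tree D A" "labels A \<subseteq> edges G" "\<A> \<subseteq> tree_tuples A S"
  shows "\<chi> D S ((\<lambda>x. restrict x (tree_verts D - S)) ` \<A>) \<le> \<chi> A S \<A>"
  using assms
proof (induction arbitrary: \<A> rule: sub_tree.induct)
  case (bot A)
  let ?\<pi> = "(\<lambda>x. restrict x (tree_verts (Leaf None :: 'v set join_tree) - S)) ` \<A>"
  have v: "tree_verts (Leaf None) = {}" by (simp add: tree_verts_def tree_graph_def graph_of_edges_def)
  show ?case
  proof (cases "\<A> = {}")
    case True thus ?thesis using chi_empty[of "Leaf None" S] by simp
  next
    case False
    \<comment> \<open>The only tuple over no vertices is the extensional function
      \<open>\<lambda>_. undefined\<close>. So the projection costs at most 1, and the nonempty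
      \<open>\<A>\<close> costs at least 1.\<close>
    have "?\<pi> \<subseteq> {\<lambda>_. undefined}" by (auto simp: v)
    hence c: "card ?\<pi> \<le> 1" using card_mono[of "{\<lambda>_. undefined}" ?\<pi>] by simp
    have "\<chi> (Leaf None) S ?\<pi> \<le> card ?\<pi>"
      by (rule chi_le_card[OF G \<theta>_nonneg n]) (auto simp: v tuples_def)
    thus ?thesis using c chi_pos[OF bot False] by linarith
  qed
next
  case (refl A)
  have "restrict x (tree_verts A - S) = x" if "x \<in> \<A>" for x
    using refl(2) that by (auto intro: restrict_eq_tuples)
  hence "(\<lambda>x. restrict x (tree_verts A - S)) ` \<A> = \<A>" by force
  thus ?case by (simp only: order_refl)
next
  case (left D B C)
  have l: "labels B \<subseteq> edges G" using left.prems(1) by simp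
  show ?case by (rule chi_projection_Join_le[OF left.hyps left.prems left.IH[OF l]])
next
  case (right D C B)
  have l: "labels C \<subseteq> edges G" "labels (Join C B) \<subseteq> edges G"
    and A: "\<A> \<subseteq> tree_tuples (Join C B) S"
    using right.prems by (simp_all add: tree_verts_Join Un_commute)
  have "\<chi> D S ((\<lambda>x. restrict x (tree_verts D - S)) ` \<A>) \<le> \<chi> (Join C B) S \<A>"
    by (rule chi_projection_Join_le[OF right.hyps l(2) A right.IH[OF l(1)]])
  thus ?case by (simp only: chi_Join_commute[OF right.prems])
qed

section \<open>The optimal exponent\<close>

text \<open>This is \<open>\<Psi>(A|S)\<close> of the overview. The empty set is excluded because
  its density is 0, and the logarithm needs a base above 1, hence the hypothesis
  \<open>2 \<le> n\<close> in what follows.\<close>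

definition exponent :: "'v set join_tree \<Rightarrow> 'v set \<Rightarrow> real" where
  "exponent A S = Inf {log n (\<chi> A S \<A> / \<mu> A S \<A>) |\<A>. \<A> \<subseteq> tree_tuples A S \<and> \<A> \<noteq> {}}"

text \<open>For nonempty \<open>\<A>\<close> the number 1 separates the two sides. This gives
  nonnegativity of \<open>exponent\<close> and settles \<open>n = 1\<close>.\<close>

lemma density_le_chi:
  assumes A: "labels A \<subseteq> edges G" "\<A> \<subseteq> tree_tuples A S"
  shows "\<mu> A S \<A> \<le> \<chi> A S \<A>"
proof (cases "\<A> = {}")
  case True thus ?thesis by (simp add: density_def)
next
  case False
  thus ?thesis using density_le_1[OF finite_tree_verts[OF A(1)] A(2)] chi_pos[OF A] by linarith
qed

lemma le_exponent_iff:
  assumes n2: "2 \<le> n" and l: "labels A \<subseteq> edges G"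
  shows "t \<le> exponent A S
    \<longleftrightarrow> (\<forall>\<A>. \<A> \<subseteq> tree_tuples A S \<longrightarrow> n powr t * \<mu> A S \<A> \<le> \<chi> A S \<A>)"
proof -
  let ?X = "{log n (\<chi> A S \<A> / \<mu> A S \<A>) |\<A>. \<A> \<subseteq> tree_tuples A S \<and> \<A> \<noteq> {}}"
  have iff: "t \<le> log n (\<chi> A S \<A> / \<mu> A S \<A>) \<longleftrightarrow> n powr t * \<mu> A S \<A> \<le> \<chi> A S \<A>"
    if A: "\<A> \<subseteq> tree_tuples A S" "\<A> \<noteq> {}" for t \<A>
  proof -
    note p = density_pos[OF finite_tree_verts[OF l] A n]
    have "0 < \<chi> A S \<A> / \<mu> A S \<A>" using p chi_pos[OF l A] by simp
    hence "t \<le> log n (\<chi> A S \<A> / \<mu> A S \<A>) \<longleftrightarrow> n powr t \<le> \<chi> A S \<A> / \<mu> A S \<A>"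
      using n2 by (subst le_log_iff) auto
    also have "\<dots> \<longleftrightarrow> n powr t * \<mu> A S \<A> \<le> \<chi> A S \<A>" by (rule pos_le_divide_eq[OF p])
    finally show ?thesis .
  qed
  have "?X \<noteq> {}" using tuples_nonempty[OF n, of "tree_verts A - S"] by blast
  moreover have "bdd_below ?X"
  proof (rule bdd_belowI[of _ 0])
    fix x assume "x \<in> ?X"
    then obtain \<A> where x: "x = log n (\<chi> A S \<A> / \<mu> A S \<A>)" and A: "\<A> \<subseteq> tree_tuples A S" "\<A> \<noteq> {}"
      by blast
    \<comment> \<open>By \<open>iff\<close> with \<open>t = 0\<close> this is
      \<open>density_le_chi\<close>.\<close>
    show "0 \<le> x" unfolding x iff[OF A] using density_le_chi[OF l A(1)] n by simp
  qed
  ultimately have "t \<le> exponent A S \<longleftrightarrow> (\<forall>x\<in>?X. t \<le> x)"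
    unfolding exponent_def by (rule le_cInf_iff)
  also have "\<dots> \<longleftrightarrow> (\<forall>\<A>. \<A> \<subseteq> tree_tuples A S \<and> \<A> \<noteq> {} \<longrightarrow> n powr t * \<mu> A S \<A> \<le> \<chi> A S \<A>)"
  proof -
    have "(\<forall>x\<in>?X. t \<le> x)
      \<longleftrightarrow> (\<forall>\<A>. \<A> \<subseteq> tree_tuples A S \<and> \<A> \<noteq> {} \<longrightarrow> t \<le> log n (\<chi> A S \<A> / \<mu> A S \<A>))"
      by blast
    thus ?thesis using iff by simp
  qed
  also have "\<dots> \<longleftrightarrow> (\<forall>\<A>. \<A> \<subseteq> tree_tuples A S \<longrightarrow> n powr t * \<mu> A S \<A> \<le> \<chi> A S \<A>)"
  proof (rule iff_allI)
    fix \<A>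
    show "(\<A> \<subseteq> tree_tuples A S \<and> \<A> \<noteq> {} \<longrightarrow> n powr t * \<mu> A S \<A> \<le> \<chi> A S \<A>)
      \<longleftrightarrow> (\<A> \<subseteq> tree_tuples A S \<longrightarrow> n powr t * \<mu> A S \<A> \<le> \<chi> A S \<A>)"
      by (cases "\<A> = {}") (simp_all add: density_def)
  qed
  finally show ?thesis .
qed

lemma exponent_bound:
  assumes "2 \<le> n" "labels A \<subseteq> edges G" "\<A> \<subseteq> tree_tuples A S"
  shows "\<mu> A S \<A> \<le> \<chi> A S \<A> * n powr (- exponent A S)"
  using le_exponent_iff[OF assms(1,2), THEN iffD1, OF order_refl] assms(3) le_mult_powr_minus_iff n
  by simp

section \<open>Criteria for lower bounds on the exponent\<close>

text \<open>The hypothesis is linear in complexity, so it can be summed over a cover from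
  \<open>chi_cover_pathsets\<close>, with subadditivity of density on the left.\<close>

lemma le_exponentI_pathset:
  assumes n2: "2 \<le> n" and l: "labels A \<subseteq> edges G"
    and le: "\<And>\<A>. \<A> \<in> \<P> A S \<Longrightarrow> \<mu> A S \<A> \<le> \<chi> A S \<A> * n powr (- t)"
  shows "t \<le> exponent A S"
  unfolding le_exponent_iff[OF n2 l]
proof (intro allI impI)
  fix \<A> assume A: "\<A> \<subseteq> tree_tuples A S"
  obtain m :: nat and \<A>s where s: "\<And>i. i < m \<Longrightarrow> \<A>s i \<in> \<P> A S" "\<A> \<subseteq> (\<Union>i<m. \<A>s i)"
    "(\<Sum>i<m. \<chi> A S (\<A>s i)) \<le> \<chi> A S \<A>"
    using chi_cover_pathsets[OF l A] by metis
  have "\<mu> A S \<A> \<le> (\<Sum>i<m. \<mu> A S (\<A>s i))"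
    using s(1) pathsets_subset_tuples by (intro density_UN_le finite_tree_verts l s(2)) blast
  also have "\<dots> \<le> (\<Sum>i<m. \<chi> A S (\<A>s i) * n powr (- t))" using le s(1) by (intro sum_mono) auto
  also have "\<dots> = real (\<Sum>i<m. \<chi> A S (\<A>s i)) * n powr (- t)" by (simp add: sum_distrib_right)
  also have "\<dots> \<le> \<chi> A S \<A> * n powr (- t)"
    using s(3) by (intro mult_right_mono) (simp_all only: of_nat_le_iff powr_ge_zero)
  finally show "n powr t * \<mu> A S \<A> \<le> \<chi> A S \<A>" using n by (subst (asm) le_mult_powr_minus_iff) simp_all
qed

text \<open>Sum the hypothesis over an optimal decomposition: the maxima add up exactly to the
  complexity.\<close>

lemma le_exponentI_Join:
  assumes n2: "2 \<le> n" and l: "labels (Join B C) \<subseteq> edges G"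
    and le: "\<And>\<A> \<B> \<C>. \<A> \<in> \<P> (Join B C) S \<Longrightarrow> \<B> \<in> \<P> B S \<Longrightarrow> \<C> \<in> \<P> C S
      \<Longrightarrow> \<A> \<subseteq> join_sets n (tree_verts B - S) (tree_verts C - S) \<B> \<C>
      \<Longrightarrow> \<mu> (Join B C) S \<A> \<le> max (\<chi> B S \<B>) (\<chi> C S \<C>) * n powr (- t)"
  shows "t \<le> exponent (Join B C) S"
  unfolding le_exponent_iff[OF n2 l]
proof (intro allI impI)
  fix \<A> assume A: "\<A> \<subseteq> tree_tuples (Join B C) S"
  obtain m \<A>s \<B>s \<C>s where D: "decomposition B C S m \<A>s \<B>s \<C>s" "\<A> \<subseteq> (\<Union>i<m. \<A>s i)"
    "\<chi> (Join B C) S \<A> = (\<Sum>i<m. max (\<chi> B S (\<B>s i)) (\<chi> C S (\<C>s i)))"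
    by (rule chi_Join_attained[OF l A])
  have "\<mu> (Join B C) S \<A> \<le> (\<Sum>i<m. \<mu> (Join B C) S (\<A>s i))"
    using decompositionD(1)[OF D(1)] pathsets_subset_tuples
    by (intro density_UN_le finite_tree_verts l D(2)) blast
  also have "\<dots> \<le> (\<Sum>i<m. real (max (\<chi> B S (\<B>s i)) (\<chi> C S (\<C>s i))) * n powr (- t))"
    using le decompositionD[OF D(1)] by (intro sum_mono) auto
  also have "\<dots> = \<chi> (Join B C) S \<A> * n powr (- t)"
    unfolding D(3) by (simp add: sum_distrib_right)
  finally show "n powr t * \<mu> (Join B C) S \<A> \<le> \<chi> (Join B C) S \<A>"
    using n by (subst (asm) le_mult_powr_minus_iff) simp_all
qed

text \<open>The core of (i) and (ii): condition \<open>\<A> \<subseteq> \<B> \<bowtie> \<C>\<close> on the coordinates in \<open>V(B)\<close>.\<close>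

lemma density_join_le:
  assumes l: "labels (Join B C) \<subseteq> edges G"
    and B: "\<B> \<subseteq> tree_tuples B S"
    and A: "\<A> \<subseteq> join_sets n (tree_verts B - S) (tree_verts C - S) \<B> \<C>"
    and m: "\<And>z. z \<in> tuples n (S \<union> tree_verts B)
      \<Longrightarrow> \<mu> C (S \<union> tree_verts B) (restriction n (tree_verts C - S) (S \<union> tree_verts B) \<C> z) \<le> m"
  shows "\<mu> (Join B C) S \<A> \<le> \<mu> B S \<B> * m"
proof -
  let ?T = "S \<union> tree_verts B" and ?V = "tree_verts (Join B C) - S"
  have i: "?V \<inter> ?T = tree_verts B - S" and d: "?V - ?T = tree_verts C - ?T"
    "tree_verts C - S - ?T = tree_verts C - ?T" "tree_verts B - S - ?T = {}"
    by (auto simp: tree_verts_Join)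
  have lC: "labels C \<subseteq> edges G" using l by simp
  have "\<mu> (Join B C) S \<A> \<le> density n (?V \<inter> ?T) \<B> * m"
  proof (rule density_le_projection[OF finite_tree_verts[OF l] n])
    show "\<A> \<subseteq> tree_tuples (Join B C) S" using A by (auto simp: join_sets_def tree_verts_Join Un_Diff)
    show "\<B> \<subseteq> tuples n (?V \<inter> ?T)" using B i by simp
    show "restrict x (?V \<inter> ?T) \<in> \<B>" if "x \<in> \<A>" for x
      using A that unfolding i by (auto simp: join_sets_def)
    fix z assume z: "z \<in> tuples n ?T"
    have "restriction n ?V ?T \<A> z
      \<subseteq> join_sets n {} (tree_verts C - ?T) (restriction n (tree_verts B - S) ?T \<B> z)
          (restriction n (tree_verts C - S) ?T \<C> z)"
      using restriction_join_sets_subset[OF A, of ?T z] unfolding d by (simp add: tree_verts_Join Un_Diff)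
    \<comment> \<open>The first factor has no coordinates left, so points of this join are tuples on
      the coordinates of the second factor, and belong to it.\<close>
    also have "\<dots> \<subseteq> restriction n (tree_verts C - S) ?T \<C> z"
      by (auto simp: join_sets_def dest: restrict_eq_tuples)
    finally have "density n (?V - ?T) (restriction n ?V ?T \<A> z)
        \<le> \<mu> C ?T (restriction n (tree_verts C - S) ?T \<C> z)"
      unfolding d(1) using restriction_subset_tuples[of n "tree_verts C - S" ?T \<C> z]
      by (intro density_mono finite_tree_verts[OF lC]) (simp_all add: d)
    thus "density n (?V - ?T) (restriction n ?V ?T \<A> z) \<le> m" using m[OF z] by simp
  qed
  thus ?thesis by (simp only: i)
qed

section \<open>The inequalities (i), (ii) and (iii) for the exponent\<close>

text \<open>The coordinates in \<open>tree_verts B\<close> are bounded through the complexity of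
  \<open>\<B>\<close>, the remaining ones by the pathset condition on \<open>\<C>\<close>.\<close>

lemma exponent_Join_left:
  assumes n2: "2 \<le> n" and l: "labels (Join B C) \<subseteq> edges G" and S: "S \<subseteq> verts G"
  shows "exponent B S + Delta_tree \<theta> C (S \<union> tree_verts B) \<le> exponent (Join B C) S"
proof (rule le_exponentI_Join[OF n2 l])
  fix \<A> \<B> \<C> assume P: "\<A> \<in> \<P> (Join B C) S" "\<B> \<in> \<P> B S" "\<C> \<in> \<P> C S"
    and sub: "\<A> \<subseteq> join_sets n (tree_verts B - S) (tree_verts C - S) \<B> \<C>"
  let ?T = "S \<union> tree_verts B"
  have lB: "labels B \<subseteq> edges G" using l by simp
  have T: "?T \<subseteq> verts G" using S tree_verts_subset[OF G lB] by simp
  have "\<mu> (Join B C) S \<A> \<le> \<mu> B S \<B> * n powr (- Delta_tree \<theta> C ?T)"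
    by (rule density_join_le[OF l pathsets_subset_tuples[OF P(2)] sub])
      (rule density_restriction_pathset[OF P(3) _ T], auto)
  also have "\<dots> \<le> \<chi> B S \<B> * n powr (- exponent B S) * n powr (- Delta_tree \<theta> C ?T)"
    by (intro mult_right_mono exponent_bound n2 lB pathsets_subset_tuples[OF P(2)]) simp
  also have "\<dots> = \<chi> B S \<B> * n powr (- (exponent B S + Delta_tree \<theta> C ?T))"
    by (simp add: powr_add[symmetric] mult.assoc)
  also have "\<dots> \<le> max (\<chi> B S \<B>) (\<chi> C S \<C>) * n powr (- (exponent B S + Delta_tree \<theta> C ?T))"
    by (intro mult_right_mono) auto
  finally show "\<mu> (Join B C) S \<A>
    \<le> max (\<chi> B S \<B>) (\<chi> C S \<C>) * n powr (- (exponent B S + Delta_tree \<theta> C ?T))" .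
qed

text \<open>The roles are exchanged: \<open>\<B>\<close> is bounded as a pathset, while the
  restrictions of \<open>\<C>\<close> are bounded through their complexity, which is at most that of
  \<open>\<C>\<close>.\<close>

lemma exponent_Join_right:
  assumes n2: "2 \<le> n" and l: "labels (Join B C) \<subseteq> edges G" and S: "S \<subseteq> verts G"
  shows "Delta_tree \<theta> B S + exponent C (S \<union> tree_verts B) \<le> exponent (Join B C) S"
proof (rule le_exponentI_Join[OF n2 l])
  fix \<A> \<B> \<C> assume P: "\<A> \<in> \<P> (Join B C) S" "\<B> \<in> \<P> B S" "\<C> \<in> \<P> C S"
    and sub: "\<A> \<subseteq> join_sets n (tree_verts B - S) (tree_verts C - S) \<B> \<C>"
  let ?T = "S \<union> tree_verts B"
  have lC: "labels C \<subseteq> edges G" using l by simp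
  have e: "tree_verts C - S - ?T = tree_verts C - ?T" by auto
  have "\<mu> (Join B C) S \<A> \<le> \<mu> B S \<B> * (\<chi> C S \<C> * n powr (- exponent C ?T))"
  proof (rule density_join_le[OF l pathsets_subset_tuples[OF P(2)] sub])
    fix z assume z: "z \<in> tuples n ?T"
    let ?\<rho> = "restriction n (tree_verts C - S) ?T \<C> z"
    have "\<mu> C ?T ?\<rho> \<le> \<chi> C ?T ?\<rho> * n powr (- exponent C ?T)"
      using restriction_subset_tuples[of n "tree_verts C - S" ?T \<C> z]
      by (intro exponent_bound n2 lC) (simp add: e)
    also have "\<dots> \<le> \<chi> C S \<C> * n powr (- exponent C ?T)"
      using chi_restriction_le[OF _ z lC pathsets_subset_tuples[OF P(3)]]
      by (intro mult_right_mono) auto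
    finally show "\<mu> C ?T ?\<rho> \<le> \<chi> C S \<C> * n powr (- exponent C ?T)" .
  qed
  also have "\<dots> \<le> n powr (- Delta_tree \<theta> B S)
      * (max (\<chi> B S \<B>) (\<chi> C S \<C>) * n powr (- exponent C ?T))"
    by (intro mult_mono density_pathset[OF P(2) S n]) auto
  also have "\<dots> = max (\<chi> B S \<B>) (\<chi> C S \<C>)
      * n powr (- (Delta_tree \<theta> B S + exponent C ?T))"
    by (simp add: powr_add[symmetric] mult_ac)
  finally show "\<mu> (Join B C) S \<A>
    \<le> max (\<chi> B S \<B>) (\<chi> C S \<C>) * n powr (- (Delta_tree \<theta> B S + exponent C ?T))" .
qed

text \<open>The projection to \<open>tree_verts D\<close> and the restrictions over it each have
  complexity at most that of \<open>\<A>\<close>, which therefore enters squared; the factor 1/2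
  compensates for this.\<close>

lemma exponent_sub_tree:
  assumes n2: "2 \<le> n" and l: "labels A \<subseteq> edges G" and S: "S \<subseteq> verts G" and D: "sub_tree D A"
  shows "(exponent D S + exponent A (S \<union> tree_verts D) + Delta_tree \<theta> A S) / 2 \<le> exponent A S"
    (is "?t / 2 \<le> _")
proof (rule le_exponentI_pathset[OF n2 l])
  fix \<A> assume P: "\<A> \<in> \<P> A S"
  let ?T = "S \<union> tree_verts D" and ?\<pi> = "(\<lambda>x. restrict x (tree_verts D - S)) ` \<A>"
  let ?c = "real (\<chi> A S \<A>)" and ?V = "tree_verts A - S"
  note A = pathsets_subset_tuples[OF P]
  have lD: "labels D \<subseteq> edges G" using l labels_sub_tree[OF D] by auto
  have v: "tree_verts D \<subseteq> tree_verts A" by (rule tree_verts_sub_tree[OF D])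
  have i: "?V \<inter> ?T = tree_verts D - S" and d: "?V - ?T = tree_verts A - ?T" using v by auto
  have \<pi>: "?\<pi> \<subseteq> tree_tuples D S"
    using A v by (auto intro!: restrict_tuples[of _ n ?V])
  have "\<mu> A S \<A> \<le> density n (?V \<inter> ?T) ?\<pi> * (?c * n powr (- exponent A ?T))"
  proof (rule density_le_projection[OF finite_tree_verts[OF l] n A])
    show "?\<pi> \<subseteq> tuples n (?V \<inter> ?T)" using \<pi> i by simp
    show "restrict x (?V \<inter> ?T) \<in> ?\<pi>" if "x \<in> \<A>" for x using that i by simp
    fix z assume z: "z \<in> tuples n ?T"
    let ?\<rho> = "restriction n ?V ?T \<A> z"
    have "\<mu> A ?T ?\<rho> \<le> \<chi> A ?T ?\<rho> * n powr (- exponent A ?T)"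
      using restriction_subset_tuples[of n ?V ?T \<A> z] by (intro exponent_bound n2 l) (simp add: d)
    also have "\<dots> \<le> ?c * n powr (- exponent A ?T)"
      using chi_restriction_le[OF _ z l A] by (intro mult_right_mono) auto
    finally show "density n (?V - ?T) ?\<rho> \<le> ?c * n powr (- exponent A ?T)" by (simp only: d)
  qed
  also have "\<dots> \<le> (?c * n powr (- exponent D S)) * (?c * n powr (- exponent A ?T))"
  proof (rule mult_right_mono)
    have "\<mu> D S ?\<pi> \<le> \<chi> D S ?\<pi> * n powr (- exponent D S)" by (rule exponent_bound[OF n2 lD \<pi>])
    also have "\<dots> \<le> ?c * n powr (- exponent D S)"
      using chi_projection_le[OF D l A] by (intro mult_right_mono) auto
    finally show "density n (?V \<inter> ?T) ?\<pi> \<le> ?c * n powr (- exponent D S)" by (simp only: i)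
  qed simp
  \<comment> \<open>A second factor \<open>\<mu> A S \<A>\<close>, bounded by the pathset condition
    at \<open>S\<close>, turns the left side into a square as well.\<close>
  finally have "\<mu> A S \<A> * \<mu> A S \<A>
      \<le> ((?c * n powr (- exponent D S)) * (?c * n powr (- exponent A ?T))) * n powr (- Delta_tree \<theta> A S)"
    using density_pathset[OF P S n] by (intro mult_mono) (auto simp: density_nonneg)
  also have "\<dots> = ?c * ?c * n powr (- ?t)"
    by (simp add: powr_add[symmetric] mult_ac)
  also have "\<dots> = (?c * n powr (- (?t / 2)))\<^sup>2"
    by (simp add: power2_eq_square powr_add[symmetric] mult_ac)
  finally have "(\<mu> A S \<A>)\<^sup>2 \<le> (?c * n powr (- (?t / 2)))\<^sup>2" by (simp add: power2_eq_square)
  thus "\<mu> A S \<A> \<le> ?c * n powr (- (?t / 2))" by (rule power2_le_imp_le) simp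
qed

lemma exponent_Join_commute:
  assumes "labels (Join B C) \<subseteq> edges G"
  shows "exponent (Join B C) S = exponent (Join C B) S"
proof -
  have "tree_verts (Join B C) = tree_verts (Join C B)" by (auto simp: tree_verts_Join)
  thus ?thesis
    unfolding exponent_def using chi_Join_commute[OF assms]
    by (intro arg_cong[of _ _ Inf] Collect_cong) (metis (no_types, lifting))
qed

lemma admissible_exponent:
  assumes n2: "2 \<le> n"
  shows "admissible G \<theta> exponent"
  unfolding admissible_def
proof (intro allI impI conjI)
  fix A S assume l: "labels A \<subseteq> edges G" and S: "S \<subseteq> verts G"
  show "0 \<le> exponent A S"
    unfolding le_exponent_iff[OF n2 l] using density_le_chi[OF l] n by simp
  show "(exponent D S + exponent A (S \<union> tree_verts D) + Delta_tree \<theta> A S) / 2 \<le> exponent A S"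
    if "sub_tree D A \<and> D \<noteq> A" for D
    using that by (intro exponent_sub_tree[OF n2 l S]) blast
  fix B C assume "A = Join B C \<or> A = Join C B"
  \<comment> \<open>Admissibility asks for both orders of the children; symmetry leaves only
    \<open>Join B C\<close>.\<close>
  hence e: "exponent A S = exponent (Join B C) S" and "labels (Join B C) \<subseteq> edges G"
    using exponent_Join_commute[of B C S] l by auto
  thus "exponent B S + Delta_tree \<theta> C (S \<union> tree_verts B) \<le> exponent A S"
    "Delta_tree \<theta> B S + exponent C (S \<union> tree_verts B) \<le> exponent A S"
    using exponent_Join_left[OF n2 _ S] exponent_Join_right[OF n2 _ S] by auto
qed

theorem chi_ge_Phi:
  assumes l: "labels A \<subseteq> edges G" and S: "S \<subseteq> verts G" and A: "\<A> \<subseteq> tree_tuples A S"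
  shows "n powr Phi G \<theta> A S * \<mu> A S \<A> \<le> \<chi> A S \<A>"
proof (cases "2 \<le> n")
  case True
  have "Phi G \<theta> A S \<le> exponent A S" by (rule Phi_least[OF admissible_exponent[OF True] l S])
  thus ?thesis using le_exponent_iff[OF True l] A by blast
next
  \<comment> \<open>The power of \<open>n = 1\<close> is 1 whatever the exponent, so the trivial
    bound is enough.\<close>
  case False
  hence "n = 1" using n by simp
  thus ?thesis using density_le_chi[OF l A] by simp
qed

end

section \<open>The lower bound on \<open>tau\<close>\<close>

text \<open>Compare \<open>G\<close> with the subgraph of all its edges: the edge sums agree, so
  \<open>\<Delta> \<ge> 0\<close> there and \<open>\<Delta> = 0\<close> for \<open>G\<close> force
  equal numbers of vertices.\<close>

lemma threshold_weighting_no_isolated: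
  assumes G: "finite_graph G" and \<theta>: "\<theta> \<in> threshold_weightings G"
  shows "verts G = \<Union>(edges G)"
proof (rule card_subset_eq[symmetric])
  show f: "finite (verts G)" and sub: "\<Union>(edges G) \<subseteq> verts G"
    using G by (auto simp: finite_graph_def)
  have "graph_of_edges (edges G) \<in> subgraphs G" by (auto simp: subgraphs_def)
  hence "0 \<le> Delta \<theta> (graph_of_edges (edges G))" "Delta \<theta> G = 0"
    using \<theta> by (auto simp: threshold_weightings_def)
  hence "card (verts G) \<le> card (\<Union>(edges G))" by (simp add: Delta_def graph_of_edges_def)
  thus "card (\<Union>(edges G)) = card (verts G)" using card_mono[OF f sub] by simp
qed

theorem theorem4p4:
  fixes G :: "'v graph"
  assumes "finite_graph G"
  shows "tau G \<ge> (SUP \<theta>\<in>threshold_weightings G. INF A\<in>{A. tree_graph A = G}. Phi G \<theta> A {})"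
proof (cases "threshold_weightings G = {}")
  \<comment> \<open>Both sides are then the supremum of the empty set of reals, hence the same
    value.\<close>
  case True
  thus ?thesis by (simp add: tau_def)
next
  case False
  then have V: "verts G = \<Union>(edges G)" using threshold_weighting_no_isolated[OF assms] by blast
  have l: "labels A = edges G" and v: "tree_verts A = verts G" if "tree_graph A = G" for A
    using that by (auto simp: tree_graph_def graph_of_edges_def tree_verts_def)
  show ?thesis
  proof (rule cSUP_least[OF False])
    fix \<theta> assume \<theta>: "\<theta> \<in> threshold_weightings G"
    let ?t = "INF A\<in>{A. tree_graph A = G}. Phi G \<theta> A {}"
    have pos: "0 \<le> Phi G \<theta> A {}" if "tree_graph A = G" for A
      using admissible_nonneg[OF admissible_Phi[OF assms \<theta>]] l[OF that] by simp
    have le: "?t \<le> Phi G \<theta> A {}" if "tree_graph A = G" for A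
      using pos that by (intro cINF_lower bdd_belowI2[of _ 0]) auto
    \<comment> \<open>Only nonnegative exponents compete in \<open>tau\<close>. The infimum is over
      a nonempty set because some join-tree has graph \<open>G\<close>.\<close>
    have "0 \<le> ?t" using tree_graph_exists[OF assms V] pos by (intro cINF_greatest) auto
    moreover have "real n powr ?t * density n (verts G) \<A> \<le> chi G \<theta> n A {} \<A>"
      if A: "tree_graph A = G" and n: "1 \<le> n" and "\<A> \<subseteq> tuples n (verts G)" for A n \<A>
    proof -
      \<comment> \<open>The exponent \<open>?t\<close> does not depend on \<open>n\<close>, so the
        locale can be entered for each \<open>n\<close> separately.\<close>
      interpret pathset_setting G \<theta> n
        using assms \<theta> n by unfold_locales (auto simp: threshold_weightings_def)
      have "real n powr ?t * density n (verts G) \<A> \<le> real n powr Phi G \<theta> A {} * density n (verts G) \<A>"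
        using le[OF A] n by (intro mult_right_mono powr_mono density_nonneg) auto
      also have "\<dots> \<le> chi G \<theta> n A {} \<A>"
        using chi_ge_Phi[of A "{}" \<A>] l[OF A] v[OF A] that(3) by simp
      finally show ?thesis .
    qed
    ultimately show "?t \<le> tau G"
      unfolding tau_def using \<theta>
      by (intro cSup_upper tau_bdd_above[OF assms V] CollectI conjI bexI[of _ \<theta>]) auto
  qed
qed

end
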